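(* Let $N\ge1$ and let $\mathscr{A}$ be a set of real $N\times N$ matrices obtained as the value $P(\mathscr{A}_1,\dots,\mathscr{A}_n)$ of a polynomial Minkowski mapping with positive coefficients, each of whose arguments $\mathscr{A}_1,\dots,\mathscr{A}_n$ is either a finite nonempty linearly ordered set of non-negative matrices or a nonempty compact IRU-set of non-negative matrices. Then for any compact set $\tilde{\mathscr{A}}$ of real $N\times N$ matrices satisfying $\mathscr{A}\subseteq\tilde{\mathscr{A}}\subseteq\operatorname{co}(\mathscr{A})$ (with $\operatorname{co}$ denoting convex hull) the following hold: (i) $\check{\rho}_{m}(\tilde{\mathscr{A}})=\rho_{\min}(\mathscr{A})$ for all $m\ge 1$, and therefore $\check{\rho}(\tilde{\mathscr{A}})=\rho_{\min}(\tilde{\mathscr{A}})=\rho_{\min}(\mathscr{A})$; (ii) $\hat{\rho}_{m}(\tilde{\mathscr{A}})=\rho_{\max}(\mathscr{A})$ for all $m\ge 1$, and therefore $\hat{\rho}(\tilde{\mathscr{A}})=\rho_{\max}(\tilde{\mathscr{A}})=\rho_{\max}(\mathscr{A})$.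
   Context: For matrices $A,B$ of the same size, $A\le B$ is meant entrywise; $A$ is non-negative if $A\ge0$. A set of real $K\times L$ matrices is an independent row uncertainty set (IRU-set) if there are sets of rows $\mathscr{R}_1,\dots,\mathscr{R}_K\subset\mathbb{R}^{L}$ such that it consists of all $K\times L$ matrices whose $i$-th row belongs to $\mathscr{R}_i$ for each $i$. A finite set $\{A_1,\dots,A_k\}$ of matrices of the same size is a linearly ordered set of non-negative matrices if (for a suitable numbering) $0\le A_1\le A_2\le\cdots\le A_k$. Minkowski operations on sets of matrices: $\mathscr{A}+\mathscr{B}=\{A+B: A\in\mathscr{A},B\in\mathscr{B}\}$, $\mathscr{A}\mathscr{B}=\{AB: A\in\mathscr{A},B\in\mathscr{B}\}$, $t\mathscr{A}=\{tA:A\in\mathscr{A}\}$ for scalars $t$. Polynomial Minkowski mapping: for integers $n,d\ge1$, $$P(\mathscr{A}_{1},\ldots,\mathscr{A}_{n})=\sum_{k=1}^{d}\ \sum_{i_{1},\ldots,i_{k}\in\{1,\ldots,n\}}p_{i_{1},\ldots,i_{k}}\,\mathscr{A}_{i_{1}}\mathscr{A}_{i_{2}}\cdots\mathscr{A}_{i_{k}},$$ with positive scalar coefficients $p_{i_1,\dots,i_k}$, where sums and products are Minkowski operations (so different occurrences of the same $\mathscr{A}_i$ are chosen independently). The sum may be restricted to any finite nonempty collection of index words $(i_1,\dots,i_k)$, and the arguments $\mathscr{A}_i$ may consist of matrices of different (rectangular) sizes, provided all the products occurring are defined and consist of $N\times N$ matrices. $\rho(A)$ denotes the spectral radius of a square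 matrix $A$. For a set $\mathscr{S}$ of $N\times N$ matrices and $m\ge1$: $$\rho_{\min}(\mathscr{S})=\min_{A\in\mathscr{S}}\rho(A),\quad \rho_{\max}(\mathscr{S})=\max_{A\in\mathscr{S}}\rho(A),$$ $$\hat{\rho}_{m}(\mathscr{S})=\sup_{A_1,\dots,A_m\in\mathscr{S}}\rho(A_m\cdots A_1)^{1/m},\quad \check{\rho}_{m}(\mathscr{S})=\inf_{A_1,\dots,A_m\in\mathscr{S}}\rho(A_m\cdots A_1)^{1/m}.$$ The generalized spectral radius of a bounded set $\mathscr{S}$ is $\hat{\rho}(\mathscr{S})=\sup_{m\ge1}\hat{\rho}_m(\mathscr{S})$. The lower spectral radius is $\check{\rho}(\mathscr{S})=\inf_{m\ge1}\check{\rho}_m(\mathscr{S})$, which is known to equal $\lim_{m\to\infty}\inf_{A_i\in\mathscr{S}}\|A_m\cdots A_1\|^{1/m}$ for any operator norm. *)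

theory Defs
  imports
    "HOL-Analysis.Function_Topology"
    "HOL-Library.Set_Algebras"
    "Jordan_Normal_Form.Spectral_Radius"
begin

text \<open>Matrices have type \<^typ>\<open>real mat\<close>, so that matrices of different rectangular sizes can be
  multiplied; their sizes are fixed by \<^const>\<open>carrier_mat\<close>. The order \<open>\<le>\<close> on them is entrywise
  and also requires equal dimensions. On sets of matrices, \<open>+\<close> and \<open>*\<close> are the Minkowski
  operations of \<^theory>\<open>HOL-Library.Set_Algebras\<close>.\<close>

definition nonneg_matrix :: "real mat \<Rightarrow> bool" where
  "nonneg_matrix A \<longleftrightarrow> 0\<^sub>m (dim_row A) (dim_col A) \<le> A"

text \<open>The type of matrices carries no topology. A \<open>K \<times> L\<close> matrix is identified with its array of
  entries, padded by zeros; for fixed \<open>K, L\<close> this embeds the Euclidean space of \<open>K \<times> L\<close> matrices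
  linearly and homeomorphically into the product space of doubly indexed families of reals.\<close>

definition mat_entries :: "real mat \<Rightarrow> nat \<times> nat \<Rightarrow> real" where
  "mat_entries A = (\<lambda>(i, j). if i < dim_row A \<and> j < dim_col A then A $$ (i, j) else 0)"

definition compact_mats :: "real mat set \<Rightarrow> bool" where
  "compact_mats S \<longleftrightarrow> compact (mat_entries ` S)"

text \<open>The library notions of convex set and convex hull need a vector space type, so
  they are repeated here for matrices. Since \<^term>\<open>carrier_mat K L\<close> is itself convex, the hull
  of a set of \<open>K \<times> L\<close> matrices consists of \<open>K \<times> L\<close> matrices.\<close>

definition convex_mats :: "real mat set \<Rightarrow> bool" where
  "convex_mats S \<longleftrightarrow>
     (\<forall>A\<in>S. \<forall>B\<in>S. \<forall>u\<ge>0. \<forall>v\<ge>0. u + v = 1 \<longrightarrow> u \<cdot>\<^sub>m A + v \<cdot>\<^sub>m B \<in> S)"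

definition mat_convex_hull :: "real mat set \<Rightarrow> real mat set" where
  "mat_convex_hull S = convex_mats hull S"

definition IRU_set :: "nat \<Rightarrow> nat \<Rightarrow> real mat set \<Rightarrow> bool" where
  "IRU_set K L S \<longleftrightarrow>
     (\<exists>R :: nat \<Rightarrow> real vec set. (\<forall>i<K. R i \<subseteq> carrier_vec L) \<and>
        S = {A \<in> carrier_mat K L. \<forall>i<K. row A i \<in> R i})"

definition linearly_ordered_nonneg :: "nat \<Rightarrow> nat \<Rightarrow> real mat set \<Rightarrow> bool" where
  "linearly_ordered_nonneg K L S \<longleftrightarrow>
     S \<subseteq> carrier_mat K L \<and> (\<exists>As. S = set As \<and> sorted_wrt (\<le>) (0\<^sub>m K L # As))"

text \<open>Sums and products of nonempty lists. They are used both for matrices and for sets of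
  matrices, where no unit element of unspecified size is available.\<close>

fun sum_list1 :: "'a::plus list \<Rightarrow> 'a" where
  "sum_list1 [x] = x"
| "sum_list1 (x # y # xs) = x + sum_list1 (y # xs)"

fun prod_list1 :: "'a::times list \<Rightarrow> 'a" where
  "prod_list1 [x] = x"
| "prod_list1 (x # y # xs) = x * prod_list1 (y # xs)"

definition scale_mats :: "real \<Rightarrow> real mat set \<Rightarrow> real mat set" where
  "scale_mats t S = (\<lambda>A. t \<cdot>\<^sub>m A) ` S"

text \<open>A polynomial is given by a list \<open>ws\<close> enumerating its index words and a coefficient
  \<open>p w\<close> for each word \<open>w\<close>. \<open>F i\<close> is the \<open>i\<close>-th argument.\<close>

definition minkowski_poly ::
    "(nat list \<Rightarrow> real) \<Rightarrow> nat list list \<Rightarrow> (nat \<Rightarrow> real mat set) \<Rightarrow> real mat set" where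
  "minkowski_poly p ws F =
     sum_list1 (map (\<lambda>w. scale_mats (p w) (prod_list1 (map F w))) ws)"

text \<open>If the \<open>i\<close>-th argument consists of \<open>r i \<times> c i\<close> matrices, the product along \<open>w\<close> is defined
  and consists of \<open>N \<times> N\<close> matrices.\<close>

definition word_compatible ::
    "(nat \<Rightarrow> nat) \<Rightarrow> (nat \<Rightarrow> nat) \<Rightarrow> nat \<Rightarrow> nat list \<Rightarrow> bool" where
  "word_compatible r c N w \<longleftrightarrow>
     r (hd w) = N \<and> c (last w) = N \<and>
     (\<forall>j. Suc j < length w \<longrightarrow> c (w ! j) = r (w ! Suc j))"

definition spec_rad :: "real mat \<Rightarrow> real" where
  "spec_rad A = spectral_radius (map_mat complex_of_real A)"

text \<open>\<open>rho_min\<close> and \<open>rho_max\<close> are a genuine minimum and maximum, not merely an infimum and supremum: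
  the terms below are unspecified if the extremum is not attained.\<close>

definition rho_min :: "real mat set \<Rightarrow> real" where
  "rho_min S = (LEAST x. x \<in> spec_rad ` S)"

definition rho_max :: "real mat set \<Rightarrow> real" where
  "rho_max S = (GREATEST x. x \<in> spec_rad ` S)"

definition rho_hat_m :: "nat \<Rightarrow> real mat set \<Rightarrow> real" where
  "rho_hat_m m S =
     Sup {root m (spec_rad (prod_list1 As)) | As. length As = m \<and> set As \<subseteq> S}"

definition rho_check_m :: "nat \<Rightarrow> real mat set \<Rightarrow> real" where
  "rho_check_m m S =
     Inf {root m (spec_rad (prod_list1 As)) | As. length As = m \<and> set As \<subseteq> S}"

definition generalized_spectral_radius :: "real mat set \<Rightarrow> real" where
  "generalized_spectral_radius S = (SUP m\<in>{1..}. rho_hat_m m S)"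

definition lower_spectral_radius :: "real mat set \<Rightarrow> real" where
  "lower_spectral_radius S = (INF m\<in>{1..}. rho_check_m m S)"

end

theory Submission
  imports Defs
begin

text \<open>Call a set of non-negative matrices selective if for each \<open>u \<ge> 0\<close> some member \<open>A\<close> makes
  \<open>A u\<close> minimal among all images of \<open>u\<close>, and some member makes it maximal. Ordered sets (take the
  least or greatest matrix) and compact IRU-sets (optimise row by row) are selective, and selectivity
  passes to Minkowski sums and products. Add a small \<open>e > 0\<close> to all entries and pick \<open>A\<close> with least
  (greatest) perturbed spectral radius. Its Perron vector \<open>u > 0\<close> must have \<open>A u\<close> as the minimal
  (maximal) image, so \<open>u\<close> is super- (sub-)invariant for every perturbed matrix of the set and hence
  of its convex hull. This bounds the spectral radii of all products, and \<open>e\<close> tends to \<open>0\<close> by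
  continuity of the spectral radius and compactness.\<close>

section \<open>Sub- and superinvariant vectors\<close>

text \<open>A non-negative matrix may be reducible, and a non-negative eigenvector for its spectral
  radius can then have zero coordinates. Such a vector is no help for upper bounds, since
  \<open>A u \<le> t u\<close> bounds the spectral radius by \<open>t\<close> only if
  \<open>u > 0\<close>; moreover, a strict inequality in one coordinate need not move the spectral
  radius. Both defects vanish for entrywise positive matrices, which is why \<open>e\<close> is
  added to all entries. This shifts all images of a fixed \<open>u\<close> by the same amount, so a
  selection made in the original set remains one after perturbation, although perturbing does not
  commute with Minkowski products. The two limits \<open>e \<rightarrow> 0\<close> differ. From
  above, the extremal matrix varies with \<open>e\<close>, and a limit matrix has to be extracted by
  compactness. From below, perturbing does not lower the spectral radius, so the bound is
  independent of \<open>e\<close> and only the product itself has to converge.\<close>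

text \<open>Vectors are plain functions, of which only the values below the column number matter;
  this spares dimension conditions when images are fed into matrices of other sizes.\<close>

definition mat_act :: "real mat \<Rightarrow> (nat \<Rightarrow> real) \<Rightarrow> nat \<Rightarrow> real" where
  "mat_act A u i = (\<Sum>j<dim_col A. A $$ (i, j) * u j)"

lemma nonneg_matrix_iff:
  "nonneg_matrix A \<longleftrightarrow> (\<forall>i<dim_row A. \<forall>j<dim_col A. 0 \<le> A $$ (i, j))"
  by (simp add: nonneg_matrix_def less_eq_mat_def)

lemma mat_act_add:
  assumes "A \<in> carrier_mat K L" "B \<in> carrier_mat K L" "i < K"
  shows "mat_act (A + B) u i = mat_act A u i + mat_act B u i"
  using assms by (simp add: mat_act_def distrib_right sum.distrib)

lemma mat_act_smult:
  assumes "A \<in> carrier_mat K L" "i < K"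
  shows "mat_act (t \<cdot>\<^sub>m A) u i = t * mat_act A u i"
  using assms by (simp add: mat_act_def sum_distrib_left mult.assoc)

lemma mat_act_mult:
  assumes "A \<in> carrier_mat K M" "B \<in> carrier_mat M L" "i < K"
  shows "mat_act (A * B) u i = mat_act A (mat_act B u) i"
proof -
  have "mat_act (A * B) u i = (\<Sum>j<L. \<Sum>k<M. A $$ (i, k) * B $$ (k, j) * u j)"
    using assms by (auto simp: mat_act_def scalar_prod_def sum_distrib_right lessThan_atLeast0
        intro!: sum.cong)
  also have "\<dots> = (\<Sum>k<M. \<Sum>j<L. A $$ (i, k) * B $$ (k, j) * u j)"
    by (rule sum.swap)
  also have "\<dots> = mat_act A (mat_act B u) i"
    using assms by (simp add: mat_act_def sum_distrib_left mult.assoc)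
  finally show ?thesis .
qed

lemma mat_act_mono:
  assumes "A \<in> carrier_mat K L" "nonneg_matrix A" "i < K" "\<And>j. j < L \<Longrightarrow> u j \<le> v j"
  shows "mat_act A u i \<le> mat_act A v i"
  using assms by (auto simp: mat_act_def nonneg_matrix_iff intro!: sum_mono mult_left_mono)

lemma mat_act_nonneg:
  assumes "A \<in> carrier_mat K L" "nonneg_matrix A" "i < K" "\<And>j. j < L \<Longrightarrow> 0 \<le> u j"
  shows "0 \<le> mat_act A u i"
  using assms by (auto simp: mat_act_def nonneg_matrix_iff intro!: sum_nonneg)

lemma mat_act_cmult: "mat_act A (\<lambda>j. t * u j) i = t * mat_act A u i"
  by (simp add: mat_act_def sum_distrib_left mult_ac)

lemma nonneg_matrix_add:
  assumes "A \<in> carrier_mat K L" "B \<in> carrier_mat K L" "nonneg_matrix A" "nonneg_matrix B"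
  shows "nonneg_matrix (A + B)"
  using assms by (auto simp: nonneg_matrix_iff)

lemma nonneg_matrix_smult: "t \<ge> 0 \<Longrightarrow> nonneg_matrix A \<Longrightarrow> nonneg_matrix (t \<cdot>\<^sub>m A)"
  by (auto simp: nonneg_matrix_iff)

lemma nonneg_matrix_mult:
  assumes "A \<in> carrier_mat K M" "B \<in> carrier_mat M L" "nonneg_matrix A" "nonneg_matrix B"
  shows "nonneg_matrix (A * B)"
  using assms by (auto simp: nonneg_matrix_iff scalar_prod_def intro!: sum_nonneg)

lemma index_mult_mat_vec_sum:
  assumes "A \<in> carrier_mat K L" "v \<in> carrier_vec L" "i < K"
  shows "(A *\<^sub>v v) $ i = (\<Sum>j<L. A $$ (i, j) * v $ j)"
  using assms by (auto simp: scalar_prod_def lessThan_atLeast0)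

text \<open>No sign condition is imposed, so the dominant eigenvalue and its eigenvector are complex
  in general; \<open>k\<close> records that the eigenvector is nonzero.\<close>

lemma spec_rad_eigenvector:
  assumes A: "A \<in> carrier_mat N N" and N: "N > 0"
  obtains z k w where "cmod z = spec_rad A" "k < N" "w k \<noteq> 0"
    "\<And>i. i < N \<Longrightarrow> (\<Sum>j<N. complex_of_real (A $$ (i, j)) * w j) = z * w i"
proof -
  let ?C = "map_mat complex_of_real A"
  have C: "?C \<in> carrier_mat N N" using A by simp
  obtain z where z: "eigenvalue ?C z" "cmod z = spec_rad A"
    using spectral_radius_mem_max(1)[OF C N] by (auto simp: spec_rad_def spectrum_def)
  then obtain v where v: "v \<in> carrier_vec N" "v \<noteq> 0\<^sub>v N" "?C *\<^sub>v v = z \<cdot>\<^sub>v v"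
    using A by (auto simp: eigenvalue_def eigenvector_def)
  obtain k where k: "k < N" "v $ k \<noteq> 0"
    using v(1,2) by (metis carrier_vecD eq_vecI index_zero_vec)
  have "(\<Sum>j<N. complex_of_real (A $$ (i, j)) * v $ j) = z * v $ i" if "i < N" for i
    using index_mult_mat_vec_sum[OF C v(1) that] v(1,3) A that by simp
  with that[of z k "\<lambda>i. v $ i"] z k show thesis by blast
qed

lemma cmod_eigenvalue_le_spec_rad:
  assumes A: "A \<in> carrier_mat N N" and z: "eigenvalue (map_mat complex_of_real A) z"
  shows "cmod z \<le> spec_rad A"
proof -
  have C: "map_mat complex_of_real A \<in> carrier_mat N N" using A by simp
  show ?thesis
    using spectral_radius_mem_max(2)[OF C eigenvalue_imp_nonzero_dim[OF C z]] z
    by (auto simp: spec_rad_def spectrum_def)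
qed

lemma spec_rad_nonneg:
  assumes "A \<in> carrier_mat N N" "N > 0"
  shows "0 \<le> spec_rad A"
  using spec_rad_eigenvector[OF assms] by (metis norm_ge_zero)

text \<open>A row-sum estimate with weights \<open>u\<close>: for an eigenvector \<open>w\<close> of
  a dominant eigenvalue take the least \<open>M\<close> with \<open>|w| \<le> M u\<close>, and read
  the eigenvalue equation at an index where equality holds.\<close>

lemma spec_rad_leI:
  assumes A: "A \<in> carrier_mat N N" and N: "N > 0"
    and u: "\<And>i. i < N \<Longrightarrow> 0 < u i"
    and le: "\<And>i. i < N \<Longrightarrow> (\<Sum>j<N. \<bar>A $$ (i, j)\<bar> * u j) \<le> t * u i"
  shows "spec_rad A \<le> t"
proof -
  obtain z k w where z: "cmod z = spec_rad A" and k: "k < N" "w k \<noteq> 0"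
    and eig: "\<And>i. i < N \<Longrightarrow> (\<Sum>j<N. complex_of_real (A $$ (i, j)) * w j) = z * w i"
    using spec_rad_eigenvector[OF A N] by blast
  define M where "M = Max ((\<lambda>i. cmod (w i) / u i) ` {..<N})"
  have "M \<in> (\<lambda>i. cmod (w i) / u i) ` {..<N}"
    unfolding M_def using N by (intro Max_in) auto
  then obtain i where i: "i < N" "M = cmod (w i) / u i" by auto
  have M: "cmod (w j) \<le> M * u j" if "j < N" for j
  proof -
    have "cmod (w j) / u j \<le> M" unfolding M_def using that by (intro Max_ge) auto
    then show ?thesis using u[OF that] by (simp add: divide_le_eq)
  qed
  have wi: "cmod (w i) = M * u i" using i u[of i] by simp
  have "0 < M * u k" using M[OF k(1)] k(2) by (smt (verit) zero_less_norm_iff)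
  then have M0: "M > 0" using u[OF k(1)] by (simp add: zero_less_mult_iff)
  have "spec_rad A * (M * u i) = cmod (\<Sum>j<N. complex_of_real (A $$ (i, j)) * w j)"
    using eig[OF i(1)] z wi by (simp add: norm_mult)
  also have "\<dots> \<le> (\<Sum>j<N. \<bar>A $$ (i, j)\<bar> * cmod (w j))"
    by (rule order_trans[OF norm_sum]) (simp add: norm_mult)
  also have "\<dots> \<le> (\<Sum>j<N. \<bar>A $$ (i, j)\<bar> * (M * u j))"
    by (intro sum_mono mult_left_mono M) auto
  also have "\<dots> = M * (\<Sum>j<N. \<bar>A $$ (i, j)\<bar> * u j)"
    by (simp add: sum_distrib_left mult_ac)
  also have "\<dots> \<le> M * (t * u i)" using le[OF i(1)] M0 by simp
  finally have "M * u i * spec_rad A \<le> M * u i * t" by (simp add: mult_ac)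
  then show ?thesis using M0 u[OF i(1)] by simp
qed

lemma spec_rad_le_subinvariant:
  assumes A: "A \<in> carrier_mat N N" and N: "N > 0" and nn: "nonneg_matrix A"
    and u: "\<And>i. i < N \<Longrightarrow> 0 < u i"
    and le: "\<And>i. i < N \<Longrightarrow> mat_act A u i \<le> t * u i"
  shows "spec_rad A \<le> t"
proof (rule spec_rad_leI[OF A N u])
  fix i assume i: "i < N"
  have "(\<Sum>j<N. \<bar>A $$ (i, j)\<bar> * u j) = mat_act A u i"
    using A i nn by (auto simp: mat_act_def nonneg_matrix_iff intro!: sum.cong)
  with le[OF i] show "(\<Sum>j<N. \<bar>A $$ (i, j)\<bar> * u j) \<le> t * u i" by simp
qed

text \<open>Scaling by \<open>1 / t\<close> brings the spectral radius below 1, where the Jordan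
  normal form keeps all powers bounded.\<close>

lemma pow_mat_entry_bound:
  assumes A: "A \<in> carrier_mat N N" and N: "N > 0" and t: "spec_rad A < t"
  obtains b where "\<And>k i j. i < N \<Longrightarrow> j < N \<Longrightarrow> \<bar>(A ^\<^sub>m k) $$ (i, j)\<bar> \<le> b * t ^ k"
proof -
  have t0: "t > 0" using spec_rad_nonneg[OF A N] t by simp
  define B where "B = (1 / t) \<cdot>\<^sub>m A"
  have B: "B \<in> carrier_mat N N" using A by (simp add: B_def)
  obtain z k w where z: "cmod z = spec_rad B" and k: "k < N" "w k \<noteq> 0"
    and eig: "\<And>i. i < N \<Longrightarrow> (\<Sum>j<N. complex_of_real (B $$ (i, j)) * w j) = z * w i"
    using spec_rad_eigenvector[OF B N] by blast
  \<comment> \<open>Scaling back turns a dominant eigenvalue \<open>z\<close> of \<open>B\<close>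
    into the eigenvalue \<open>t * z\<close> of \<open>A\<close>, whence \<open>t * cmod z\<close>
    is at most \<open>spec_rad A < t\<close>.\<close>
  have "eigenvector (map_mat complex_of_real A) (vec N w) (complex_of_real t * z)"
    unfolding eigenvector_def
  proof (intro conjI)
    show "vec N w \<noteq> 0\<^sub>v (dim_row (map_mat complex_of_real A))"
    proof
      assume "vec N w = 0\<^sub>v (dim_row (map_mat complex_of_real A))"
      then have "vec N w $ k = 0\<^sub>v N $ k" using A by simp
      with k show False by simp
    qed
    show "map_mat complex_of_real A *\<^sub>v vec N w = (complex_of_real t * z) \<cdot>\<^sub>v vec N w"
    proof (rule eq_vecI)
      fix i assume "i < dim_vec ((complex_of_real t * z) \<cdot>\<^sub>v vec N w)"
      then have i: "i < N" by simp
      have "(map_mat complex_of_real A *\<^sub>v vec N w) $ i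
          = (\<Sum>j<N. map_mat complex_of_real A $$ (i, j) * vec N w $ j)"
        by (rule index_mult_mat_vec_sum[of _ N]) (use A i in auto)
      also have "\<dots> = complex_of_real t * (\<Sum>j<N. complex_of_real (B $$ (i, j)) * w j)"
        unfolding sum_distrib_left using A i t0 by (auto simp: B_def intro!: sum.cong)
      also have "\<dots> = ((complex_of_real t * z) \<cdot>\<^sub>v vec N w) $ i" using i eig by simp
      finally show "(map_mat complex_of_real A *\<^sub>v vec N w) $ i
          = ((complex_of_real t * z) \<cdot>\<^sub>v vec N w) $ i" .
    qed (use A in simp)
  qed (use A in simp)
  then have "eigenvalue (map_mat complex_of_real A) (complex_of_real t * z)"
    by (auto simp: eigenvalue_def)
  then have "t * cmod z \<le> spec_rad A"
    using cmod_eigenvalue_le_spec_rad[OF A] t0 by (metis abs_of_pos norm_mult norm_of_real)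
  with t have "t * cmod z < t * 1" by linarith
  then have "spectral_radius (map_mat complex_of_real B) < 1"
    using t0 z by (simp add: spec_rad_def)
  then obtain b where b: "\<And>k. norm_bound (map_mat complex_of_real B ^\<^sub>m k) b"
    using spectral_radius_jnf_norm_bound_less_1_upper_triangular[of "map_mat complex_of_real B" N] B
    by auto
  have pow: "map_mat complex_of_real B ^\<^sub>m k = map_mat complex_of_real (B ^\<^sub>m k)" for k
    by (rule of_real_hom.mat_hom_pow[OF B, symmetric])
  have powB: "B ^\<^sub>m k = (1 / t) ^ k \<cdot>\<^sub>m (A ^\<^sub>m k)" for k
  proof (induction k)
    case (Suc k)
    have "B ^\<^sub>m Suc k = ((1 / t) ^ k \<cdot>\<^sub>m (A ^\<^sub>m k)) * ((1 / t) \<cdot>\<^sub>m A)"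
      by (simp add: Suc[symmetric]) (simp add: B_def)
    also have "\<dots> = (1 / t) ^ Suc k \<cdot>\<^sub>m (A ^\<^sub>m Suc k)"
      using A pow_carrier_mat[OF A, of k] by (intro eq_matI) (auto simp: mult_ac)
    finally show ?case .
  qed (use A in \<open>auto simp: B_def\<close>)
  show thesis
  proof (rule that[of b])
    fix k i j assume ij: "i < N" "j < N"
    have dims: "A ^\<^sub>m k \<in> carrier_mat N N" using A by (rule pow_carrier_mat)
    have "norm ((map_mat complex_of_real B ^\<^sub>m k) $$ (i, j)) \<le> b"
      using b[of k] ij carrier_matD[OF pow_carrier_mat, of "map_mat complex_of_real B" N k] B
      unfolding norm_bound_def by (simp del: index_map_mat)
    also have "norm ((map_mat complex_of_real B ^\<^sub>m k) $$ (i, j)) = \<bar>(B ^\<^sub>m k) $$ (i, j)\<bar>"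
      using ij carrier_matD[OF pow_carrier_mat[OF B, of k]] unfolding pow by (simp del: pow_mat_dim)
    also have "\<dots> = \<bar>(A ^\<^sub>m k) $$ (i, j)\<bar> / t ^ k"
      using ij dims t0 unfolding powB by (simp add: abs_mult power_one_over del: pow_mat_dim)
    finally have "\<bar>(A ^\<^sub>m k) $$ (i, j)\<bar> / t ^ k \<le> b" .
    then show "\<bar>(A ^\<^sub>m k) $$ (i, j)\<bar> \<le> b * t ^ k" using t0 by (simp add: divide_le_eq)
  qed
qed

text \<open>Iteration shows that the powers of \<open>A\<close> grow at least like
  \<open>t ^ n\<close> at \<open>k\<close>, whereas a spectral radius below \<open>t\<close> forces
  slower growth. One positive coordinate suffices, in contrast to the upper bound.\<close>

lemma spec_rad_ge_superinvariant:
  assumes A: "A \<in> carrier_mat N N" and nn: "nonneg_matrix A"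
    and u: "\<And>i. i < N \<Longrightarrow> 0 \<le> u i" and k: "k < N" "0 < u k"
    and ge: "\<And>i. i < N \<Longrightarrow> t * u i \<le> mat_act A u i"
  shows "t \<le> spec_rad A"
proof (rule ccontr)
  assume "\<not> t \<le> spec_rad A"
  \<comment> \<open>Two gaps are needed: the bound on powers holds only strictly above the spectral
    radius, and \<open>t / s > 1\<close> makes the comparison fail for large exponents.\<close>
  then obtain s where s: "spec_rad A < s" "s < t" using dense by (meson not_le)
  have N: "N > 0" using k by simp
  have s0: "s > 0" using spec_rad_nonneg[OF A N] s by simp
  obtain b where b: "\<And>k i j. i < N \<Longrightarrow> j < N \<Longrightarrow> \<bar>(A ^\<^sub>m k) $$ (i, j)\<bar> \<le> b * s ^ k"
    using pow_mat_entry_bound[OF A N s(1)] by blast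
  have grow: "\<forall>i<N. t ^ n * u i \<le> mat_act (A ^\<^sub>m n) u i" for n
  proof (induction n)
    case 0
    have "mat_act (A ^\<^sub>m 0) u i = u i" if "i < N" for i
    proof -
      have "mat_act (A ^\<^sub>m 0) u i = (\<Sum>j<N. if j = i then u j else 0)"
        unfolding mat_act_def by (rule sum.cong) (use A that in auto)
      then show ?thesis using that by simp
    qed
    then show ?case by simp
  next
    case (Suc n)
    have P: "A ^\<^sub>m n \<in> carrier_mat N N" using A by (rule pow_carrier_mat)
    have nnP: "nonneg_matrix (A ^\<^sub>m n)"
    proof (induction n)
      case 0 show ?case using A by (auto simp: nonneg_matrix_iff)
    next
      case (Suc n) then show ?case
        using nonneg_matrix_mult[OF pow_carrier_mat[OF A] A Suc nn] by simp
    qed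
    show ?case
    proof (intro allI impI)
      fix i assume i: "i < N"
      have "t ^ Suc n * u i \<le> t * mat_act (A ^\<^sub>m n) u i"
        using Suc i s s0 by (simp add: mult_left_mono mult.assoc)
      also have "\<dots> = mat_act (A ^\<^sub>m n) (\<lambda>j. t * u j) i" by (simp add: mat_act_cmult)
      also have "\<dots> \<le> mat_act (A ^\<^sub>m n) (mat_act A u) i"
        by (rule mat_act_mono[OF P nnP i ge])
      also have "\<dots> = mat_act (A ^\<^sub>m Suc n) u i"
        using mat_act_mult[OF P A i] by simp
      finally show "t ^ Suc n * u i \<le> mat_act (A ^\<^sub>m Suc n) u i" .
    qed
  qed
  define C where "C = b * (\<Sum>j<N. u j) / u k"
  have "(t / s) ^ n \<le> C" for n
  proof -
    have "t ^ n * u k \<le> mat_act (A ^\<^sub>m n) u k" using grow k by blast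
    also have "\<dots> \<le> (\<Sum>j<N. b * s ^ n * u j)"
      unfolding mat_act_def carrier_matD(2)[OF pow_carrier_mat[OF A]]
      by (intro sum_mono mult_right_mono) (use b[OF k(1), of _ n] u in \<open>auto simp: abs_le_iff\<close>)
    also have "\<dots> = s ^ n * (b * (\<Sum>j<N. u j))" by (simp add: sum_distrib_left mult_ac)
    finally have "t ^ n * u k \<le> s ^ n * (b * (\<Sum>j<N. u j))" .
    then show ?thesis using s0 k by (simp add: C_def power_divide field_simps)
  qed
  moreover have "1 < t / s" using s s0 by simp
  ultimately show False using real_arch_pow by (meson not_le)
qed

section \<open>Perron vectors and continuity of the spectral radius\<close>

lemma mat_act_diff: "mat_act A (\<lambda>j. u j - v j) i = mat_act A u i - mat_act A v i"
  by (simp add: mat_act_def right_diff_distrib sum_subtractf)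

lemma mat_act_pos:
  assumes "A \<in> carrier_mat K L" "i < K" "\<And>j. j < L \<Longrightarrow> 0 < A $$ (i, j)"
    and "\<And>j. j < L \<Longrightarrow> 0 \<le> u j" "k < L" "0 < u k"
  shows "0 < mat_act A u i"
proof -
  have "0 < (\<Sum>j<L. A $$ (i, j) * u j)"
    using assms by (intro sum_pos2[of _ k]) (auto intro: less_imp_le mult_nonneg_nonneg)
  then show ?thesis using assms by (simp add: mat_act_def)
qed

text \<open>Positivity spreads strictness: \<open>A u - t u\<close> is non-negative and positive at
  \<open>k\<close>, so applying \<open>A\<close> makes it positive everywhere. Thus
  \<open>v = A u\<close> satisfies \<open>A v > t v\<close> in all coordinates, which leaves room
  for a factor above \<open>t\<close>.\<close>

lemma spec_rad_gt_superinvariant: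
  assumes A: "A \<in> carrier_mat N N" and pos: "\<And>i j. i < N \<Longrightarrow> j < N \<Longrightarrow> 0 < A $$ (i, j)"
    and u: "\<And>i. i < N \<Longrightarrow> 0 \<le> u i"
    and ge: "\<And>i. i < N \<Longrightarrow> t * u i \<le> mat_act A u i"
    and k: "k < N" "t * u k < mat_act A u k"
  shows "t < spec_rad A"
proof -
  have nn: "nonneg_matrix A" using A pos by (auto simp: nonneg_matrix_iff less_imp_le)
  define v where "v = mat_act A u"
  obtain l where l: "l < N" "0 < u l"
  proof (rule ccontr)
    assume "\<not> thesis"
    with that u have "\<And>i. i < N \<Longrightarrow> u i = 0" by force
    then have "mat_act A u k = 0" "u k = 0" using A k by (auto simp: mat_act_def)
    with k show False by simp
  qed
  have v: "0 < v i" if "i < N" for i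
    unfolding v_def using mat_act_pos[OF A that pos[OF that], of u l] u l by simp
  have gt: "t * v i < mat_act A v i" if i: "i < N" for i
  proof -
    have "0 < mat_act A (\<lambda>j. v j - t * u j) i"
      using mat_act_pos[OF A i pos[OF i], of "\<lambda>j. v j - t * u j" k] ge k by (simp add: v_def)
    then show ?thesis by (simp add: mat_act_diff mat_act_cmult v_def)
  qed
  \<comment> \<open>The least Collatz-Wielandt quotient of \<open>v\<close>, that is, its largest
    superinvariance factor.\<close>
  define s where "s = Min ((\<lambda>i. mat_act A v i / v i) ` {..<N})"
  have "s \<in> (\<lambda>i. mat_act A v i / v i) ` {..<N}"
    unfolding s_def using k by (intro Min_in) auto
  then have "t < s" using gt v by (auto simp: less_divide_eq)
  have "s \<le> spec_rad A"
  proof (rule spec_rad_ge_superinvariant[OF A nn, of v k])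
    fix i assume i: "i < N"
    have "s \<le> mat_act A v i / v i" unfolding s_def using i by (intro Min_le) auto
    then show "s * v i \<le> mat_act A v i" using v[OF i] by (simp add: le_divide_eq)
  qed (use v k in \<open>auto intro: less_imp_le\<close>)
  with \<open>t < s\<close> show ?thesis by simp
qed

text \<open>The dual argument, with \<open>t u - A u\<close> and the greatest Collatz-Wielandt
  quotient of \<open>v\<close>.\<close>

lemma spec_rad_less_subinvariant:
  assumes A: "A \<in> carrier_mat N N" and pos: "\<And>i j. i < N \<Longrightarrow> j < N \<Longrightarrow> 0 < A $$ (i, j)"
    and u: "\<And>i. i < N \<Longrightarrow> 0 < u i"
    and le: "\<And>i. i < N \<Longrightarrow> mat_act A u i \<le> t * u i"
    and k: "k < N" "mat_act A u k < t * u k"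
  shows "spec_rad A < t"
proof -
  have nn: "nonneg_matrix A" using A pos by (auto simp: nonneg_matrix_iff less_imp_le)
  define v where "v = mat_act A u"
  have v: "0 < v i" if "i < N" for i
    unfolding v_def using mat_act_pos[OF A that pos[OF that], of u k] u k by (simp add: less_imp_le)
  have lt: "mat_act A v i < t * v i" if i: "i < N" for i
  proof -
    have "0 < mat_act A (\<lambda>j. t * u j - v j) i"
      using mat_act_pos[OF A i pos[OF i], of "\<lambda>j. t * u j - v j" k] le k by (simp add: v_def)
    then show ?thesis by (simp add: mat_act_diff mat_act_cmult v_def)
  qed
  define s where "s = Max ((\<lambda>i. mat_act A v i / v i) ` {..<N})"
  have "s \<in> (\<lambda>i. mat_act A v i / v i) ` {..<N}"
    unfolding s_def using k by (intro Max_in) auto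
  then have "s < t" using lt v by (auto simp: divide_less_eq)
  have "spec_rad A \<le> s"
  proof (rule spec_rad_le_subinvariant[OF A _ nn v])
    fix i assume i: "i < N"
    have "mat_act A v i / v i \<le> s" unfolding s_def using i by (intro Max_ge) auto
    then show "mat_act A v i \<le> s * v i" using v[OF i] by (simp add: divide_le_eq)
  qed (use k in auto)
  with \<open>s < t\<close> show ?thesis by simp
qed

text \<open>The moduli of an eigenvector for a dominant eigenvalue form a superinvariant vector, which
  must be invariant.\<close>

lemma perron_vector:
  assumes A: "A \<in> carrier_mat N N" and N: "N > 0"
    and pos: "\<And>i j. i < N \<Longrightarrow> j < N \<Longrightarrow> 0 < A $$ (i, j)"
  obtains u where "\<And>i. i < N \<Longrightarrow> 0 < u i" "\<And>i. i < N \<Longrightarrow> mat_act A u i = spec_rad A * u i"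
proof -
  obtain z k w where z: "cmod z = spec_rad A" and k: "k < N" "w k \<noteq> 0"
    and eig: "\<And>i. i < N \<Longrightarrow> (\<Sum>j<N. complex_of_real (A $$ (i, j)) * w j) = z * w i"
    using spec_rad_eigenvector[OF A N] by blast
  define u where "u = (\<lambda>i. cmod (w i))"
  have ge: "spec_rad A * u i \<le> mat_act A u i" if i: "i < N" for i
  proof -
    have "spec_rad A * u i = cmod (\<Sum>j<N. complex_of_real (A $$ (i, j)) * w j)"
      using eig[OF i] z by (simp add: u_def norm_mult)
    also have "\<dots> \<le> (\<Sum>j<N. \<bar>A $$ (i, j)\<bar> * cmod (w j))"
      by (rule order_trans[OF norm_sum]) (simp add: norm_mult)
    also have "\<dots> = mat_act A u i"
      unfolding mat_act_def u_def using A pos[OF i]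
      by (intro sum.cong) (auto simp: abs_of_pos)
    finally show ?thesis .
  qed
  \<comment> \<open>Strictness at \<open>i\<close> would yield
    \<open>spec_rad A < spec_rad A\<close>.\<close>
  have eq: "mat_act A u i = spec_rad A * u i" if "i < N" for i
    using spec_rad_gt_superinvariant[OF A pos, of u "spec_rad A" i] ge that
    by (force simp: u_def)
  have "0 < u i" if i: "i < N" for i
  proof -
    have "0 < mat_act A u i"
      using mat_act_pos[OF A i pos[OF i], of u k] k by (simp add: u_def)
    then show ?thesis using eq[OF i] by (auto simp: u_def)
  qed
  with eq that show thesis by blast
qed

section \<open>Continuity of the spectral radius through the characteristic polynomial\<close>

text \<open>By the Leibniz formula the value is a polynomial expression in the entries and the
  point. The point may move too, because eigenvalues of the approximating matrices will be
  inserted.\<close>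

lemma tendsto_char_poly:
  assumes X: "\<And>k. X k \<in> carrier_mat N N" and L: "L \<in> carrier_mat N N"
    and lim: "\<And>i j. i < N \<Longrightarrow> j < N \<Longrightarrow> ((\<lambda>k. X k $$ (i, j)) \<longlongrightarrow> L $$ (i, j)) F"
    and z: "(z \<longlongrightarrow> z0) F"
  shows "((\<lambda>k. poly (char_poly (map_mat complex_of_real (X k))) (z k))
    \<longlongrightarrow> poly (char_poly (map_mat complex_of_real L)) z0) F"
proof -
  define D where "D = (\<lambda>A (x::complex). \<Sum>p | p permutes {0..<N}. signof p *
     (\<Prod>i = 0..<N. (if i = p i then x else 0) - complex_of_real (A $$ (i, p i))))"
  have D: "poly (char_poly (map_mat complex_of_real A)) x = D A x"
    if A: "A \<in> carrier_mat N N" for A x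
  proof -
    have C: "map_mat complex_of_real A \<in> carrier_mat N N" using A by simp
    have M: "- char_matrix (map_mat complex_of_real A) x \<in> carrier_mat N N"
      using A by (simp add: char_matrix_def)
    show ?thesis
      unfolding char_poly_matrix[OF C] det_def'[OF M] D_def
    proof (intro sum.cong refl arg_cong2[of _ _ _ _ times] prod.cong)
      fix p i assume "p \<in> {p. p permutes {0..<N}}" "i \<in> {0..<N}"
      then have "i < N" "p i < N" using permutes_in_image by fastforce+
      then show "(- char_matrix (map_mat complex_of_real A) x) $$ (i, p i)
          = (if i = p i then x else 0) - complex_of_real (A $$ (i, p i))"
        using A by (auto simp: char_matrix_def)
    qed
  qed
  have "((\<lambda>k. D (X k) (z k)) \<longlongrightarrow> D L z0) F"
    unfolding D_def
  proof (intro tendsto_sum tendsto_mult tendsto_const tendsto_prod tendsto_diff tendsto_of_real lim)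
    fix p i assume "p \<in> {p. p permutes {0..<N}}" "i \<in> {0..<N}"
    then show "i < N" "p i < N" using permutes_in_image by fastforce+
    show "((\<lambda>k. if i = p i then z k else 0) \<longlongrightarrow> (if i = p i then z0 else 0)) F"
      using z by simp
  qed
  then show ?thesis by (simp add: D[OF X] D[OF L])
qed

text \<open>All roots lie in the disc of radius \<open>a\<close>, so each of the \<open>N\<close>
  linear factors has modulus at least \<open>cmod z - a\<close>.\<close>

lemma cmod_char_poly_ge:
  assumes A: "A \<in> carrier_mat N N" and le: "spec_rad A \<le> a" "a \<le> cmod z"
  shows "(cmod z - a) ^ N \<le> cmod (poly (char_poly (map_mat complex_of_real A)) z)"
proof -
  have C: "map_mat complex_of_real A \<in> carrier_mat N N" using A by simp
  obtain as where as: "char_poly (map_mat complex_of_real A) = (\<Prod>a\<leftarrow>as. [:- a, 1:])"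
    and len: "length as = N"
    using char_poly_factorized[OF C] by auto
  have "cmod b \<le> a" if "b \<in> set as" for b
  proof -
    have "eigenvalue (map_mat complex_of_real A) b"
      unfolding eigenvalue_root_char_poly[OF C] as using that by (rule linear_poly_root)
    then show ?thesis using cmod_eigenvalue_le_spec_rad[OF A] le by fastforce
  qed
  then have "(cmod z - a) ^ length as \<le> cmod (poly (\<Prod>a\<leftarrow>as. [:- a, 1:]) z)"
  proof (induction as)
    case (Cons b as)
    have "cmod z - a \<le> cmod (z - b)" using Cons.prems[of b] norm_triangle_ineq2[of z b] by simp
    then have "(cmod z - a) * (cmod z - a) ^ length as
        \<le> cmod (z - b) * cmod (poly (\<Prod>a\<leftarrow>as. [:- a, 1:]) z)"
      using Cons le by (intro mult_mono) auto
    then show ?case by (simp add: norm_mult[symmetric] algebra_simps)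
  qed simp
  then show ?thesis by (simp add: as len)
qed

lemma spec_rad_root_char_poly:
  assumes A: "A \<in> carrier_mat N N" and N: "N > 0"
  shows "\<exists>z. cmod z = spec_rad A \<and> poly (char_poly (map_mat complex_of_real A)) z = 0"
proof -
  have C: "map_mat complex_of_real A \<in> carrier_mat N N" using A by simp
  show ?thesis
    using spectral_radius_mem_max(1)[OF C N]
    unfolding spectrum_root_char_poly[OF C] spec_rad_def by auto
qed

text \<open>Bolzano-Weierstrass, by thinning out to monotone real parts and then to monotone
  imaginary parts.\<close>

lemma bounded_complex_convergent_subseq:
  fixes z :: "nat \<Rightarrow> complex"
  assumes z: "\<And>n. cmod (z n) \<le> b"
  obtains z0 q where "strict_mono q" "(\<lambda>n. z (q n)) \<longlonglongrightarrow> z0"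
proof -
  have B: "Bseq (\<lambda>n. Re (z (f n)))" "Bseq (\<lambda>n. Im (z (f n)))" for f
    using order_trans[OF abs_Re_le_cmod z] order_trans[OF abs_Im_le_cmod z]
    by (auto intro!: BseqI'[of _ b])
  obtain f where f: "strict_mono f" "monoseq (\<lambda>n. Re (z (f n)))"
    using seq_monosub[of "\<lambda>n. Re (z n)"] by auto
  obtain g where g: "strict_mono g" "monoseq (\<lambda>n. Im (z (f (g n))))"
    using seq_monosub[of "\<lambda>n. Im (z (f n))"] by auto
  obtain x where x: "(\<lambda>n. Re (z (f n))) \<longlonglongrightarrow> x"
    using Bseq_monoseq_convergent[OF B(1) f(2)] by (auto simp: convergent_def)
  obtain y where y: "(\<lambda>n. Im (z (f (g n)))) \<longlonglongrightarrow> y"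
    using Bseq_monoseq_convergent[OF B(2) g(2)] by (auto simp: convergent_def)
  have "(\<lambda>n. z (f (g n))) \<longlonglongrightarrow> Complex x y"
    unfolding tendsto_complex_iff using LIMSEQ_subseq_LIMSEQ[OF x g(1)] y by (simp add: o_def)
  with that[of "\<lambda>n. f (g n)"] f(1) g(1) show thesis by (simp add: strict_mono_def)
qed

lemma tendsto_spec_rad:
  assumes X: "\<And>k. X k \<in> carrier_mat N N" and L: "L \<in> carrier_mat N N" and N: "N > 0"
    and lim: "\<And>i j. i < N \<Longrightarrow> j < N \<Longrightarrow> (\<lambda>k. X k $$ (i, j)) \<longlonglongrightarrow> L $$ (i, j)"
  shows "(\<lambda>k. spec_rad (X k)) \<longlonglongrightarrow> spec_rad L"
proof (rule order_tendstoI)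
  fix a assume a: "a < spec_rad L"
  obtain z where z: "cmod z = spec_rad L" "poly (char_poly (map_mat complex_of_real L)) z = 0"
    using spec_rad_root_char_poly[OF L N] by blast
  have "(\<lambda>k. poly (char_poly (map_mat complex_of_real (X k))) z) \<longlonglongrightarrow> 0"
    using tendsto_char_poly[OF X L lim tendsto_const[of z]] z(2) by simp
  \<comment> \<open>If \<open>spec_rad (X k) \<le> a\<close>, all roots keep distance at least
    \<open>spec_rad L - a\<close> from \<open>z\<close>, so the value at \<open>z\<close> could not
    fall below this bound.\<close>
  then have "\<forall>\<^sub>F k in sequentially.
      cmod (poly (char_poly (map_mat complex_of_real (X k))) z) < (spec_rad L - a) ^ N"
    using a by (intro order_tendstoD(2)[OF tendsto_norm_zero]) auto
  then show "\<forall>\<^sub>F k in sequentially. a < spec_rad (X k)"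
  proof eventually_elim
    case (elim k)
    then show ?case using cmod_char_poly_ge[OF X, of k a z] a z(1) by force
  qed
next
  fix a assume a: "spec_rad L < a"
  \<comment> \<open>The sum of the moduli of all entries is a crude common bound for the spectral
    radii; it keeps a sequence of dominant eigenvalues bounded.\<close>
  have "(\<lambda>k. \<Sum>i<N. \<Sum>j<N. \<bar>X k $$ (i, j)\<bar>) \<longlonglongrightarrow> (\<Sum>i<N. \<Sum>j<N. \<bar>L $$ (i, j)\<bar>)"
    by (intro tendsto_sum tendsto_rabs lim) auto
  then have "Bseq (\<lambda>k. \<Sum>i<N. \<Sum>j<N. \<bar>X k $$ (i, j)\<bar>)"
    by (intro convergent_imp_Bseq convergentI)
  then obtain b where b: "\<And>k. \<bar>\<Sum>i<N. \<Sum>j<N. \<bar>X k $$ (i, j)\<bar>\<bar> \<le> b"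
    by (auto simp: Bseq_def)
  have bound: "spec_rad (X k) \<le> b" for k
  proof (rule spec_rad_leI[OF X N, of "\<lambda>_. 1"])
    fix i assume "i < N"
    then have "(\<Sum>j<N. \<bar>X k $$ (i, j)\<bar>) \<le> (\<Sum>i<N. \<Sum>j<N. \<bar>X k $$ (i, j)\<bar>)"
      by (intro member_le_sum) (auto intro: sum_nonneg)
    then show "(\<Sum>j<N. \<bar>X k $$ (i, j)\<bar> * 1) \<le> b * 1" using b[of k] by simp
  qed simp
  show "\<forall>\<^sub>F k in sequentially. spec_rad (X k) < a"
  proof (rule ccontr)
    assume "\<not> ?thesis"
    \<comment> \<open>Dominant eigenvalues along this subsequence accumulate at a root of the limit
      polynomial, that is, at an eigenvalue of \<open>L\<close> of modulus at least
      \<open>a\<close>.\<close>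
    then obtain r :: "nat \<Rightarrow> nat" where r: "strict_mono r" "\<And>n. a \<le> spec_rad (X (r n))"
      using not_eventually_sequentiallyD by (metis not_less)
    have "\<forall>n. \<exists>z. cmod z = spec_rad (X (r n)) \<and>
        poly (char_poly (map_mat complex_of_real (X (r n)))) z = 0"
      using spec_rad_root_char_poly[OF X N] by blast
    then obtain z where z: "\<And>n. cmod (z n) = spec_rad (X (r n))"
      "\<And>n. poly (char_poly (map_mat complex_of_real (X (r n)))) (z n) = 0"
      by metis
    obtain z0 q where q: "strict_mono q" "(\<lambda>n. z (q n)) \<longlonglongrightarrow> z0"
      using bounded_complex_convergent_subseq[of z b] z(1) bound by metis
    have "(\<lambda>n. X (r (q n)) $$ (i, j)) \<longlonglongrightarrow> L $$ (i, j)" if "i < N" "j < N" for i j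
      using LIMSEQ_subseq_LIMSEQ[OF LIMSEQ_subseq_LIMSEQ[OF lim[OF that] r(1)] q(1)]
      by (simp add: o_def)
    from tendsto_char_poly[OF X L this q(2)] z(2)
    have "(\<lambda>n. 0) \<longlonglongrightarrow> poly (char_poly (map_mat complex_of_real L)) z0" by simp
    then have "poly (char_poly (map_mat complex_of_real L)) z0 = 0"
      by (metis LIMSEQ_unique tendsto_const)
    then have "cmod z0 \<le> spec_rad L"
      using cmod_eigenvalue_le_spec_rad[OF L] eigenvalue_root_char_poly[of "map_mat complex_of_real L" N z0] L
      by simp
    moreover have "a \<le> cmod z0"
      by (rule tendsto_lowerbound[OF tendsto_norm[OF q(2)]]) (use z(1) r(2) in auto)
    ultimately show False using a by simp
  qed
qed

section \<open>Sets with simultaneous extremal selections\<close>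

lemma mat_entries_carrier:
  "A \<in> carrier_mat K L \<Longrightarrow> i < K \<Longrightarrow> j < L \<Longrightarrow> mat_entries A (i, j) = A $$ (i, j)"
  by (auto simp: mat_entries_def)

lemma compact_mats_finite: "finite S \<Longrightarrow> compact_mats S"
  by (simp add: compact_mats_def finite_imp_compact)

text \<open>The objective acts on entry arrays, where the topology lives; a negated objective gives
  maxima.\<close>

lemma compact_mats_attains_inf:
  assumes "compact_mats S" "S \<noteq> {}" "continuous_on UNIV (h :: (nat \<times> nat \<Rightarrow> real) \<Rightarrow> real)"
  obtains A where "A \<in> S" "\<And>B. B \<in> S \<Longrightarrow> h (mat_entries A) \<le> h (mat_entries B)"
proof -
  have "\<exists>x\<in>mat_entries ` S. \<forall>y\<in>mat_entries ` S. h x \<le> h y"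
    using assms by (intro continuous_attains_inf continuous_on_subset[OF assms(3)])
      (auto simp: compact_mats_def)
  with that show thesis by auto
qed

lemma continuous_on_coordinate [continuous_intros]:
  "continuous_on X f \<Longrightarrow> continuous_on X (\<lambda>x. f x i)"
  for f :: "'a::topological_space \<Rightarrow> 'b \<Rightarrow> 'c::topological_space"
  by (rule continuous_on_product_then_coordinatewise)

lemma mat_entries_add:
  assumes "A \<in> carrier_mat K L" "B \<in> carrier_mat K L"
  shows "mat_entries (A + B) = (\<lambda>ij. mat_entries A ij + mat_entries B ij)"
  using assms by (auto simp: mat_entries_def)

lemma mat_entries_smult: "mat_entries (t \<cdot>\<^sub>m A) = (\<lambda>ij. t * mat_entries A ij)"
  by (auto simp: mat_entries_def)

text \<open>Valid at every index pair: outside the product matrix the zero padding of the factors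
  makes the sum vanish.\<close>

lemma mat_entries_mult:
  assumes "A \<in> carrier_mat K M" "B \<in> carrier_mat M L"
  shows "mat_entries (A * B) = (\<lambda>ij. \<Sum>k<M. mat_entries A (fst ij, k) * mat_entries B (k, snd ij))"
proof (rule ext, clarify)
  fix i j
  show "mat_entries (A * B) (i, j)
      = (\<Sum>k<M. mat_entries A (fst (i, j), k) * mat_entries B (k, snd (i, j)))"
    using assms by (auto simp: mat_entries_def scalar_prod_def lessThan_atLeast0)
qed

text \<open>On entry arrays the Minkowski sum is a continuous image of a product of compact sets;
  the Minkowski product is treated alike.\<close>

lemma compact_mats_plus:
  assumes "S \<subseteq> carrier_mat K L" "T \<subseteq> carrier_mat K L" "compact_mats S" "compact_mats T"
  shows "compact_mats (S + T)"
proof -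
  let ?g = "\<lambda>(a, b) ij. a ij + b ij :: real"
  have "mat_entries ` (S + T) = (\<lambda>(A, B). mat_entries (A + B)) ` (S \<times> T)"
    by (auto simp: set_plus_def)
  also have "\<dots> = (\<lambda>(A, B). ?g (mat_entries A, mat_entries B)) ` (S \<times> T)"
    using assms(1,2) by (intro image_cong) (auto simp: mat_entries_add subset_iff)
  also have "\<dots> = ?g ` (mat_entries ` S \<times> mat_entries ` T)"
    by (auto simp: image_iff)
  finally have eq: "mat_entries ` (S + T) = ?g ` (mat_entries ` S \<times> mat_entries ` T)" .
  have "compact (?g ` (mat_entries ` S \<times> mat_entries ` T))"
    using assms(3,4) unfolding compact_mats_def case_prod_unfold
    by (intro compact_continuous_image compact_Times continuous_intros)
  then show ?thesis unfolding compact_mats_def eq .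
qed

lemma compact_mats_times:
  assumes "S \<subseteq> carrier_mat K M" "T \<subseteq> carrier_mat M L" "compact_mats S" "compact_mats T"
  shows "compact_mats (S * T)"
proof -
  let ?g = "\<lambda>(a, b) ij. \<Sum>k<M. a (fst ij, k) * b (k, snd ij) :: real"
  have "mat_entries ` (S * T) = (\<lambda>(A, B). mat_entries (A * B)) ` (S \<times> T)"
    by (auto simp: set_times_def)
  also have "\<dots> = (\<lambda>(A, B). ?g (mat_entries A, mat_entries B)) ` (S \<times> T)"
    using assms(1,2) by (intro image_cong) (auto simp: mat_entries_mult[of _ K M _ L] subset_iff)
  also have "\<dots> = ?g ` (mat_entries ` S \<times> mat_entries ` T)"
    by (auto simp: image_iff)
  finally have eq: "mat_entries ` (S * T) = ?g ` (mat_entries ` S \<times> mat_entries ` T)" .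
  have "compact (?g ` (mat_entries ` S \<times> mat_entries ` T))"
    using assms(3,4) unfolding compact_mats_def case_prod_unfold
    by (intro compact_continuous_image compact_Times continuous_intros)
  then show ?thesis unfolding compact_mats_def eq .
qed

lemma compact_mats_scale:
  assumes "compact_mats S"
  shows "compact_mats (scale_mats t S)"
proof -
  have eq: "mat_entries ` scale_mats t S = (\<lambda>a ij. t * a ij) ` mat_entries ` S"
    by (simp add: scale_mats_def image_image mat_entries_smult)
  have "compact ((\<lambda>a ij. t * a ij) ` mat_entries ` S)"
    using assms unfolding compact_mats_def
    by (intro compact_continuous_image continuous_intros)
  then show ?thesis unfolding compact_mats_def eq .
qed

text \<open>The sign of \<open>\<sigma>\<close> decides whether the selected matrix has the least or the greatest image.\<close>

definition selective :: "nat \<Rightarrow> nat \<Rightarrow> real mat set \<Rightarrow> bool" where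
  "selective K L S \<longleftrightarrow>
     S \<noteq> {} \<and> S \<subseteq> carrier_mat K L \<and> (\<forall>A\<in>S. nonneg_matrix A) \<and> compact_mats S \<and>
     (\<forall>(\<sigma>::real) u. (\<forall>j<L. 0 \<le> u j) \<longrightarrow>
        (\<exists>A\<in>S. \<forall>B\<in>S. \<forall>i<K. \<sigma> * mat_act A u i \<le> \<sigma> * mat_act B u i))"

lemma selectiveI:
  assumes "S \<noteq> {}" "S \<subseteq> carrier_mat K L" "\<And>A. A \<in> S \<Longrightarrow> nonneg_matrix A" "compact_mats S"
    and "\<And>(\<sigma>::real) u. (\<And>j. j < L \<Longrightarrow> 0 \<le> u j) \<Longrightarrow>
      \<exists>A\<in>S. \<forall>B\<in>S. \<forall>i<K. \<sigma> * mat_act A u i \<le> \<sigma> * mat_act B u i"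
  shows "selective K L S"
  using assms by (simp add: selective_def)

lemma selectiveD:
  assumes "selective K L S"
  shows "S \<noteq> {}" "S \<subseteq> carrier_mat K L" "\<And>A. A \<in> S \<Longrightarrow> nonneg_matrix A" "compact_mats S"
  using assms by (auto simp: selective_def)

lemma selective_select:
  fixes \<sigma> :: real
  assumes "selective K L S" "\<And>j. j < L \<Longrightarrow> 0 \<le> u j"
  obtains A where "A \<in> S"
    "\<And>B i. B \<in> S \<Longrightarrow> i < K \<Longrightarrow> \<sigma> * mat_act A u i \<le> \<sigma> * mat_act B u i"
  proof -
  have "\<exists>A\<in>S. \<forall>B\<in>S. \<forall>i<K. \<sigma> * mat_act A u i \<le> \<sigma> * mat_act B u i"
    using assms unfolding selective_def by simp
  with that show thesis by blast
qed

text \<open>Makes the bounds on products applicable to the powers of a single matrix.\<close>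

lemma selective_singleton:
  assumes "A \<in> carrier_mat K L" "nonneg_matrix A"
  shows "selective K L {A}"
  using assms by (simp add: selective_def compact_mats_finite)

section \<open>The admissible arguments and the Minkowski operations\<close>

lemma selective_linearly_ordered:
  assumes lin: "linearly_ordered_nonneg K L S" and ne: "S \<noteq> {}"
  shows "selective K L S"
proof -
  obtain As where As: "S = set As" "sorted_wrt (\<le>) (0\<^sub>m K L # As)" and car: "S \<subseteq> carrier_mat K L"
    using lin by (auto simp: linearly_ordered_nonneg_def)
  have ne': "As \<noteq> []" using ne As by auto
  have hd: "hd As \<le> B" if "B \<in> S" for B
    using that As ne' by (cases As) auto
  have last: "B \<le> last As" if "B \<in> S" for B
  proof -
    have "sorted_wrt (\<le>) (butlast As @ [last As])" using As ne' by simp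
    moreover have "B \<in> set (butlast As @ [last As])" using that As ne' by simp
    ultimately show ?thesis by (auto simp: sorted_wrt_append)
  qed
  have act_mono: "mat_act A u i \<le> mat_act B u i"
    if "A \<in> S" "B \<in> S" "A \<le> B" "i < K" "\<forall>j<L. 0 \<le> u j" for A B u i
  proof -
    have "A \<in> carrier_mat K L" "B \<in> carrier_mat K L" using car that by auto
    then show ?thesis using that unfolding mat_act_def less_eq_mat_def
      by (auto intro!: sum_mono mult_right_mono)
  qed
  show ?thesis
  proof (rule selectiveI[OF ne car])
    show "nonneg_matrix A" if "A \<in> S" for A
      using As that car by (auto simp: nonneg_matrix_def)
    show "compact_mats S" using As by (simp add: compact_mats_finite)
    fix \<sigma> :: real and u :: "nat \<Rightarrow> real" assume "\<And>j. j < L \<Longrightarrow> 0 \<le> u j"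
    then have u: "\<forall>j<L. 0 \<le> u j" by blast
    show "\<exists>A\<in>S. \<forall>B\<in>S. \<forall>i<K. \<sigma> * mat_act A u i \<le> \<sigma> * mat_act B u i"
    proof (cases "\<sigma> \<ge> 0")
      case True
      have "hd As \<in> S" using As ne' by simp
      with True show ?thesis using act_mono[OF _ _ hd _ u]
        by (intro bexI[of _ "hd As"] ballI allI impI mult_left_mono) auto
    next
      case False
      have "last As \<in> S" using As ne' by simp
      with False show ?thesis using act_mono[OF _ _ last _ u]
        by (intro bexI[of _ "last As"] ballI allI impI mult_left_mono_neg) auto
    qed
  qed
qed

lemma selective_IRU:
  assumes iru: "IRU_set K L S" and ne: "S \<noteq> {}" and cpt: "compact_mats S"
    and nn: "\<And>A. A \<in> S \<Longrightarrow> nonneg_matrix A"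
  shows "selective K L S"
proof -
  obtain R where S: "S = {A \<in> carrier_mat K L. \<forall>i<K. row A i \<in> R i}"
    using iru by (auto simp: IRU_set_def)
  have car: "S \<subseteq> carrier_mat K L" using S by auto
  show ?thesis
  proof (rule selectiveI[OF ne car nn cpt])
    fix \<sigma> :: real and u :: "nat \<Rightarrow> real"
    have act: "mat_act A u i = (\<Sum>j<L. mat_entries A (i, j) * u j)" if "A \<in> S" "i < K" for A i
      using that car by (auto simp: mat_act_def mat_entries_def)
    have "\<exists>A\<in>S. \<forall>B\<in>S. \<sigma> * mat_act A u i \<le> \<sigma> * mat_act B u i" if i: "i < K" for i
    proof -
      have "continuous_on UNIV (\<lambda>a. \<sigma> * (\<Sum>j<L. a (i, j) * u j))"
        by (intro continuous_intros)
      from compact_mats_attains_inf[OF cpt ne this] show ?thesis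
        by (metis act i)
    qed
    then obtain M where M: "\<And>i. i < K \<Longrightarrow> M i \<in> S"
      "\<And>i B. i < K \<Longrightarrow> B \<in> S \<Longrightarrow> \<sigma> * mat_act (M i) u i \<le> \<sigma> * mat_act B u i"
      by metis
    \<comment> \<open>The optimal \<open>M i\<close> may differ from coordinate to coordinate. Since
      coordinate \<open>i\<close> of an image depends on row \<open>i\<close> alone, it is enough to
      glue these rows together, and the IRU property keeps the result in \<open>S\<close>.\<close>
    define A where "A = mat K L (\<lambda>(i, j). M i $$ (i, j))"
    have row: "row A i = row (M i) i" if "i < K" for i
      using M(1)[OF that] car that by (intro eq_vecI) (auto simp: A_def)
    have "A \<in> S" unfolding S using M(1) row by (auto simp: A_def S)
    moreover have "mat_act A u i = mat_act (M i) u i" if "i < K" for i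
      using M(1)[OF that] car that by (auto simp: A_def mat_act_def)
    ultimately show "\<exists>A\<in>S. \<forall>B\<in>S. \<forall>i<K. \<sigma> * mat_act A u i \<le> \<sigma> * mat_act B u i"
      using M(2) by (intro bexI[of _ A]) auto
  qed
qed

text \<open>Both selections are made at the same \<open>u\<close> and images add, so the two optimal
  choices combine.\<close>

lemma selective_plus:
  assumes S: "selective K L S" and T: "selective K L T"
  shows "selective K L (S + T)"
proof (rule selectiveI)
  note S' = selectiveD[OF S] and T' = selectiveD[OF T]
  show "S + T \<noteq> {}" "S + T \<subseteq> carrier_mat K L"
    using S'(1,2) T'(1,2) by (fastforce simp: set_plus_def)+
  show "compact_mats (S + T)" using S'(2,4) T'(2,4) by (intro compact_mats_plus)
  show "nonneg_matrix A" if "A \<in> S + T" for A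
    using that S'(2,3) T'(2,3) by (auto simp: set_plus_def intro!: nonneg_matrix_add[of _ K L])
  fix \<sigma> :: real and u :: "nat \<Rightarrow> real" assume u: "\<And>j. j < L \<Longrightarrow> 0 \<le> u j"
  obtain A where A: "A \<in> S"
    "\<And>B i. B \<in> S \<Longrightarrow> i < K \<Longrightarrow> \<sigma> * mat_act A u i \<le> \<sigma> * mat_act B u i"
    using selective_select[OF S, of u] u by blast
  obtain A' where A': "A' \<in> T"
    "\<And>B i. B \<in> T \<Longrightarrow> i < K \<Longrightarrow> \<sigma> * mat_act A' u i \<le> \<sigma> * mat_act B u i"
    using selective_select[OF T, of u] u by blast
  have "\<sigma> * mat_act (A + A') u i \<le> \<sigma> * mat_act (B + B') u i"
    if "B \<in> S" "B' \<in> T" "i < K" for B B' i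
    using add_mono[OF A(2) A'(2), OF that(1,3) that(2,3)] A(1) A'(1) that S'(2) T'(2)
    by (simp add: mat_act_add[of _ K L] subset_iff distrib_left)
  then show "\<exists>A\<in>S + T. \<forall>B\<in>S + T. \<forall>i<K. \<sigma> * mat_act A u i \<le> \<sigma> * mat_act B u i"
    using A(1) A'(1) by (intro bexI[of _ "A + A'"]) (auto simp: set_plus_def)
qed

text \<open>The right factor is optimised for \<open>u\<close> and the left factor for the resulting image
  of \<open>u\<close>; non-negativity of the left factors makes this greedy choice optimal.\<close>

lemma selective_times:
  assumes S: "selective K M S" and T: "selective M L T"
  shows "selective K L (S * T)"
proof (rule selectiveI)
  note S' = selectiveD[OF S] and T' = selectiveD[OF T]
  show "S * T \<noteq> {}" "S * T \<subseteq> carrier_mat K L"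
    using S'(1,2) T'(1,2) by (fastforce simp: set_times_def)+
  show "compact_mats (S * T)" using S'(2,4) T'(2,4) by (intro compact_mats_times)
  show "nonneg_matrix A" if "A \<in> S * T" for A
    using that S'(2,3) T'(2,3) by (auto simp: set_times_def intro!: nonneg_matrix_mult[of _ K M _ L])
  fix \<sigma> :: real and u :: "nat \<Rightarrow> real" assume u: "\<And>j. j < L \<Longrightarrow> 0 \<le> u j"
  obtain A' where A': "A' \<in> T"
    "\<And>B i. B \<in> T \<Longrightarrow> i < M \<Longrightarrow> \<sigma> * mat_act A' u i \<le> \<sigma> * mat_act B u i"
    using selective_select[OF T, of u] u by blast
  \<comment> \<open>Selectivity of \<open>S\<close> can be invoked only at non-negative
    vectors.\<close>
  have "0 \<le> mat_act A' u j" if "j < M" for j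
    using mat_act_nonneg[of A' M L j u] T'(2,3) A'(1) that u by auto
  then obtain A where A: "A \<in> S" "\<And>B i. B \<in> S \<Longrightarrow> i < K \<Longrightarrow>
      \<sigma> * mat_act A (mat_act A' u) i \<le> \<sigma> * mat_act B (mat_act A' u) i"
    using selective_select[OF S, of "mat_act A' u"] by blast
  have "\<sigma> * mat_act (A * A') u i \<le> \<sigma> * mat_act (B * B') u i"
    if B: "B \<in> S" "B' \<in> T" "i < K" for B B' i
  proof -
    have car: "A \<in> carrier_mat K M" "A' \<in> carrier_mat M L"
      "B \<in> carrier_mat K M" "B' \<in> carrier_mat M L"
      using A(1) A'(1) B S'(2) T'(2) by auto
    have "\<sigma> * mat_act (A * A') u i = \<sigma> * mat_act A (mat_act A' u) i"
      using mat_act_mult[OF car(1,2) B(3)] by simp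
    also have "\<dots> \<le> \<sigma> * mat_act B (mat_act A' u) i"
      using A(2) B by blast
    \<comment> \<open>Moving \<open>\<sigma>\<close> into the vector lets monotonicity of the
      non-negative \<open>B\<close> serve both signs.\<close>
    also have "\<dots> = mat_act B (\<lambda>j. \<sigma> * mat_act A' u j) i" by (simp add: mat_act_cmult)
    also have "\<dots> \<le> mat_act B (\<lambda>j. \<sigma> * mat_act B' u j) i"
      using A'(2) B by (intro mat_act_mono[OF car(3) S'(3)]) auto
    also have "\<dots> = \<sigma> * mat_act (B * B') u i"
      using mat_act_mult[OF car(3,4) B(3)] by (simp add: mat_act_cmult)
    finally show ?thesis .
  qed
  then show "\<exists>A\<in>S * T. \<forall>B\<in>S * T. \<forall>i<K. \<sigma> * mat_act A u i \<le> \<sigma> * mat_act B u i"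
    using A(1) A'(1) by (intro bexI[of _ "A * A'"]) (auto simp: set_times_def)
qed

lemma selective_scale:
  assumes S: "selective K L S" and t: "0 \<le> t"
  shows "selective K L (scale_mats t S)"
proof (rule selectiveI)
  note S' = selectiveD[OF S]
  show "scale_mats t S \<noteq> {}" "scale_mats t S \<subseteq> carrier_mat K L"
    using S'(1,2) by (auto simp: scale_mats_def)
  show "compact_mats (scale_mats t S)" using S'(4) by (rule compact_mats_scale)
  show "nonneg_matrix A" if "A \<in> scale_mats t S" for A
    using that S'(3) t by (auto simp: scale_mats_def intro!: nonneg_matrix_smult)
  fix \<sigma> :: real and u :: "nat \<Rightarrow> real" assume u: "\<And>j. j < L \<Longrightarrow> 0 \<le> u j"
  obtain A where A: "A \<in> S"
    "\<And>B i. B \<in> S \<Longrightarrow> i < K \<Longrightarrow> \<sigma> * mat_act A u i \<le> \<sigma> * mat_act B u i"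
    using selective_select[OF S, of u] u by blast
  have "\<sigma> * mat_act (t \<cdot>\<^sub>m A) u i \<le> \<sigma> * mat_act (t \<cdot>\<^sub>m B) u i" if "B \<in> S" "i < K" for B i
    using mult_left_mono[OF A(2)[OF that] t] that A(1) S'(2)
    by (simp add: mat_act_smult[of _ K L] subset_iff mult.left_commute)
  then show "\<exists>A\<in>scale_mats t S. \<forall>B\<in>scale_mats t S. \<forall>i<K.
      \<sigma> * mat_act A u i \<le> \<sigma> * mat_act B u i"
    using A(1) unfolding scale_mats_def by blast
qed

lemma selective_sum_list1:
  assumes "Ss \<noteq> []" "\<And>S. S \<in> set Ss \<Longrightarrow> selective K L S"
  shows "selective K L (sum_list1 Ss)"
  using assms by (induction Ss rule: sum_list1.induct) (auto intro: selective_plus)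

lemma selective_prod_list1:
  assumes "w \<noteq> []" "\<And>i. i \<in> set w \<Longrightarrow> selective (r i) (c i) (F i)"
    and "\<And>j. Suc j < length w \<Longrightarrow> c (w ! j) = r (w ! Suc j)"
  shows "selective (r (hd w)) (c (last w)) (prod_list1 (map F w))"
  using assms
proof (induction w rule: induct_list012)
  case (3 x y w)
  have "c x = r y" using "3.prems"(3)[of 0] by simp
  moreover have "selective (r y) (c (last (y # w))) (prod_list1 (map F (y # w)))"
    using "3.IH"(2) "3.prems"(2) "3.prems"(3)[of "Suc _"] by simp
  ultimately show ?case using "3.prems"(2)[of x] by (auto intro: selective_times)
qed auto

lemma selective_minkowski_poly:
  assumes "ws \<noteq> []"
    and "\<And>w. w \<in> set ws \<Longrightarrow> w \<noteq> [] \<and> word_compatible r c N w \<and> 0 \<le> p w"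
    and "\<And>w i. w \<in> set ws \<Longrightarrow> i \<in> set w \<Longrightarrow> selective (r i) (c i) (F i)"
  shows "selective N N (minkowski_poly p ws F)"
  unfolding minkowski_poly_def
proof (rule selective_sum_list1)
  fix S assume "S \<in> set (map (\<lambda>w. scale_mats (p w) (prod_list1 (map F w))) ws)"
  then obtain w where w: "w \<in> set ws" "S = scale_mats (p w) (prod_list1 (map F w))" by auto
  then show "selective N N S"
    using assms(2)[OF w(1)] selective_prod_list1[of w r c F] assms(3)[OF w(1)]
    by (auto simp: word_compatible_def intro: selective_scale)
qed (use assms in simp)

section \<open>Extremal products\<close>

definition perturb :: "real \<Rightarrow> real mat \<Rightarrow> real mat" where
  "perturb e A = map_mat (\<lambda>x. x + e) A"

lemma perturb_carrier: "A \<in> carrier_mat K L \<Longrightarrow> perturb e A \<in> carrier_mat K L"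
  by (simp add: perturb_def)

lemma index_perturb:
  "A \<in> carrier_mat K L \<Longrightarrow> i < K \<Longrightarrow> j < L \<Longrightarrow> perturb e A $$ (i, j) = A $$ (i, j) + e"
  by (auto simp: perturb_def)

lemma perturb_pos:
  "A \<in> carrier_mat K L \<Longrightarrow> nonneg_matrix A \<Longrightarrow> 0 < e \<Longrightarrow> i < K \<Longrightarrow> j < L \<Longrightarrow> 0 < perturb e A $$ (i, j)"
  by (auto simp: index_perturb nonneg_matrix_iff add_nonneg_pos)

lemma mat_act_perturb:
  assumes "A \<in> carrier_mat K L" "i < K"
  shows "mat_act (perturb e A) u i = mat_act A u i + e * (\<Sum>j<L. u j)"
  using assms by (simp add: mat_act_def perturb_def distrib_right sum.distrib sum_distrib_left)

lemma perturb_entries: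
  "A \<in> carrier_mat K L \<Longrightarrow> perturb e A = mat K L (\<lambda>ij. mat_entries A ij + e)"
  by (rule eq_matI) (auto simp: perturb_def mat_entries_def)

lemma tendsto_coordinate:
  fixes f :: "'a \<Rightarrow> 'b \<Rightarrow> 'c::topological_space"
  assumes "(f \<longlongrightarrow> l) F"
  shows "((\<lambda>k. f k i) \<longlongrightarrow> l i) F"
  using continuous_on_tendsto_compose[OF continuous_on_product_coordinates assms] by simp

text \<open>Used with \<open>e > 0\<close> to find extremal perturbed matrices and with
  \<open>e = 0\<close> to find extremal members of the set itself.\<close>

lemma continuous_spec_rad:
  assumes "N > 0"
  shows "continuous_on UNIV (\<lambda>a. spec_rad (mat N N (\<lambda>ij. a ij + e)))"
  unfolding continuous_on_def tendsto_at_iff_sequentially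
proof (intro ballI allI impI)
  \<comment> \<open>Sequences suffice, as a product over the countable set of index pairs is first
    countable.\<close>
  fix x :: "nat \<times> nat \<Rightarrow> real" and X assume X: "X \<longlonglongrightarrow> x"
  have "(\<lambda>k. spec_rad (mat N N (\<lambda>ij. X k ij + e))) \<longlonglongrightarrow> spec_rad (mat N N (\<lambda>ij. x ij + e))"
  proof (rule tendsto_spec_rad[OF _ _ assms])
    fix i j assume "i < N" "j < N"
    then show "(\<lambda>k. mat N N (\<lambda>ij. X k ij + e) $$ (i, j)) \<longlonglongrightarrow> mat N N (\<lambda>ij. x ij + e) $$ (i, j)"
      using tendsto_add[OF tendsto_coordinate[OF X, of "(i, j)"] tendsto_const[of e]] by simp
  qed auto
  then show "((\<lambda>a. spec_rad (mat N N (\<lambda>ij. a ij + e))) \<circ> X)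
      \<longlonglongrightarrow> spec_rad (mat N N (\<lambda>ij. x ij + e))"
    by (simp add: o_def)
qed

text \<open>Perturbed matrices are positive, so their Perron vectors are positive. If the matrix
  selected at the Perron vector \<open>u\<close> of an extremal \<open>A\<close> had an image other than \<open>A u\<close>, its
  perturbed spectral radius would be even more extreme.\<close>

lemma selective_extremal_matrix:
  fixes \<sigma> :: real
  assumes S: "selective N N S" and N: "N > 0" and e: "e > 0" and \<sigma>: "\<sigma> = 1 \<or> \<sigma> = -1"
  obtains A u where "A \<in> S" "\<And>i. i < N \<Longrightarrow> 0 < u i"
    "\<And>i. i < N \<Longrightarrow> mat_act (perturb e A) u i = spec_rad (perturb e A) * u i"
    "\<And>B i. B \<in> S \<Longrightarrow> i < N \<Longrightarrow> \<sigma> * mat_act A u i \<le> \<sigma> * mat_act B u i"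
proof -
  note S' = selectiveD[OF S]
  have car: "B \<in> S \<Longrightarrow> B \<in> carrier_mat N N" for B using S'(2) by auto
  have cont: "continuous_on UNIV (\<lambda>a. \<sigma> * spec_rad (mat N N (\<lambda>ij. a ij + e)))"
    by (rule continuous_on_mult[OF continuous_on_const continuous_spec_rad[OF N]])
  obtain A where A: "A \<in> S"
    and min: "\<And>B. B \<in> S \<Longrightarrow> \<sigma> * spec_rad (perturb e A) \<le> \<sigma> * spec_rad (perturb e B)"
    using compact_mats_attains_inf[OF S'(4,1) cont] by (auto simp: perturb_entries[OF car])
  let ?l = "spec_rad (perturb e A)"
  note pos = perturb_pos[OF car S'(3) e]
  obtain u where u: "\<And>i. i < N \<Longrightarrow> 0 < u i"
    and eig: "\<And>i. i < N \<Longrightarrow> mat_act (perturb e A) u i = ?l * u i"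
    using perron_vector[OF perturb_carrier[OF car[OF A]] N pos[OF A A]] by blast
  obtain B where B: "B \<in> S"
    "\<And>C i. C \<in> S \<Longrightarrow> i < N \<Longrightarrow> \<sigma> * mat_act B u i \<le> \<sigma> * mat_act C u i"
    using selective_select[OF S, of u] u by (metis less_imp_le)
  \<comment> \<open>The shift caused by the perturbation is the same for \<open>A\<close> and
    \<open>B\<close> and cancels.\<close>
  have le: "\<sigma> * mat_act (perturb e B) u i \<le> \<sigma> * (?l * u i)" if "i < N" for i
    using B(2)[OF A that] eig[OF that] \<sigma>
    by (auto simp: mat_act_perturb[OF car[OF A] that] mat_act_perturb[OF car[OF B(1)] that])
  have "\<sigma> * mat_act A u i \<le> \<sigma> * mat_act B u i" if i: "i < N" for i
  proof (rule ccontr)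
    assume "\<not> ?thesis"
    then have less: "\<sigma> * mat_act (perturb e B) u i < \<sigma> * (?l * u i)"
      using eig[OF i] \<sigma>
      by (auto simp: mat_act_perturb[OF car[OF A] i] mat_act_perturb[OF car[OF B(1)] i])
    have "\<sigma> * spec_rad (perturb e B) < \<sigma> * ?l"
    proof (cases "\<sigma> = 1")
      case True
      have "spec_rad (perturb e B) < ?l"
        by (rule spec_rad_less_subinvariant[OF perturb_carrier[OF car[OF B(1)]], where u = u and k = i])
          (use pos[OF B(1) B(1)] u le less i True in auto)
      with True show ?thesis by simp
    next
      case False
      then have \<sigma>': "\<sigma> = -1" using \<sigma> by simp
      have "?l < spec_rad (perturb e B)"
        by (rule spec_rad_gt_superinvariant[OF perturb_carrier[OF car[OF B(1)]], where u = u and k = i])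
          (use pos[OF B(1) B(1)] u le less i \<sigma>' in \<open>auto intro: less_imp_le\<close>)
      with \<sigma>' show ?thesis by simp
    qed
    with min[OF B(1)] show False by simp
  qed
  then have "\<sigma> * mat_act A u i \<le> \<sigma> * mat_act C u i" if "C \<in> S" "i < N" for C i
    using B(2)[OF that] that by force
  with that A u eig show thesis by blast
qed

section \<open>Passage to the convex hull and to products\<close>

lemma mat_convex_hull_subset:
  assumes "S \<subseteq> P" "convex_mats P"
  shows "mat_convex_hull S \<subseteq> P"
  unfolding mat_convex_hull_def using assms by (rule hull_minimal)

lemma mat_convex_hull_nonneg:
  assumes "S \<subseteq> carrier_mat K L" "\<And>B. B \<in> S \<Longrightarrow> nonneg_matrix B" "A \<in> mat_convex_hull S"
  shows "A \<in> carrier_mat K L" "nonneg_matrix A"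
proof -
  have "convex_mats {A \<in> carrier_mat K L. nonneg_matrix A}"
    by (auto simp: convex_mats_def intro!: nonneg_matrix_add[of _ K L] nonneg_matrix_smult)
  with assms mat_convex_hull_subset[of S "{A \<in> carrier_mat K L. nonneg_matrix A}"]
  show "A \<in> carrier_mat K L" "nonneg_matrix A" by auto
qed

text \<open>For fixed \<open>u\<close> and \<open>i\<close> the inequality is linear in the matrix
  and cuts out a half-space. Having one vector \<open>u\<close> for the whole set is what lets the
  bounds survive convex combinations.\<close>

lemma mat_convex_hull_mat_act_ge:
  fixes \<sigma> :: real
  assumes S: "S \<subseteq> carrier_mat K L" and A: "A \<in> mat_convex_hull S" and i: "i < K"
    and ge: "\<And>B. B \<in> S \<Longrightarrow> t \<le> \<sigma> * mat_act B u i"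
  shows "t \<le> \<sigma> * mat_act A u i"
proof -
  let ?P = "{A \<in> carrier_mat K L. t \<le> \<sigma> * mat_act A u i}"
  have "convex_mats ?P"
    unfolding convex_mats_def
  proof (intro ballI allI impI)
    fix A B and x y :: real
    assume A: "A \<in> ?P" and B: "B \<in> ?P" and xy: "0 \<le> x" "0 \<le> y" "x + y = 1"
    have "t = x * t + y * t" using xy by (simp add: distrib_right[symmetric])
    also have "\<dots> \<le> x * (\<sigma> * mat_act A u i) + y * (\<sigma> * mat_act B u i)"
      using A B xy by (intro add_mono mult_left_mono) auto
    also have "\<dots> = \<sigma> * mat_act (x \<cdot>\<^sub>m A + y \<cdot>\<^sub>m B) u i"
      using A B i by (simp add: mat_act_add[of _ K L] mat_act_smult[of _ K L] algebra_simps)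
    finally show "x \<cdot>\<^sub>m A + y \<cdot>\<^sub>m B \<in> ?P" using A B by simp
  qed
  moreover have "S \<subseteq> ?P" using S ge by auto
  ultimately show ?thesis using mat_convex_hull_subset[of S ?P] A by auto
qed

lemma prod_list1_carrier:
  assumes "As \<noteq> []" "\<And>A. A \<in> set As \<Longrightarrow> A \<in> carrier_mat N N"
  shows "prod_list1 As \<in> carrier_mat N N"
  using assms by (induction As rule: prod_list1.induct) (auto intro: mult_carrier_mat)

lemma prod_list1_nonneg:
  assumes "As \<noteq> []" "\<And>A. A \<in> set As \<Longrightarrow> A \<in> carrier_mat N N" "\<And>A. A \<in> set As \<Longrightarrow> nonneg_matrix A"
  shows "nonneg_matrix (prod_list1 As)"
  using assms
proof (induction As rule: prod_list1.induct)
  case (2 A B As)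
  have "prod_list1 (B # As) \<in> carrier_mat N N" using "2.prems"(2) by (intro prod_list1_carrier) auto
  then show ?case using 2 nonneg_matrix_mult[of A N N "prod_list1 (B # As)" N] by simp
qed auto

text \<open>The leftmost factor is peeled off; being non-negative, it preserves the inequality known
  for the rest, and \<open>0 \<le> t\<close> permits multiplying its own inequality by a power of
  \<open>t\<close>.\<close>

lemma mat_act_prod_list1_le:
  fixes \<sigma> :: real
  assumes "As \<noteq> []" "\<And>A. A \<in> set As \<Longrightarrow> A \<in> carrier_mat N N" "\<And>A. A \<in> set As \<Longrightarrow> nonneg_matrix A"
    and t: "0 \<le> t"
    and "\<And>A i. A \<in> set As \<Longrightarrow> i < N \<Longrightarrow> \<sigma> * mat_act A u i \<le> \<sigma> * (t * u i)"
    and "i < N"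
  shows "\<sigma> * mat_act (prod_list1 As) u i \<le> \<sigma> * (t ^ length As * u i)"
  using assms(1-3,5,6)
proof (induction As arbitrary: i rule: prod_list1.induct)
  case (2 A B As)
  define P where "P = prod_list1 (B # As)"
  define m where "m = length (B # As)"
  have A: "A \<in> carrier_mat N N" "nonneg_matrix A" using "2.prems" by auto
  have P: "P \<in> carrier_mat N N" unfolding P_def using "2.prems"(2) by (intro prod_list1_carrier) auto
  have IH: "\<sigma> * mat_act P u j \<le> \<sigma> * (t ^ m * u j)" if "j < N" for j
    unfolding P_def m_def using "2.prems" that by (intro "2.IH") auto
  have "\<sigma> * mat_act (A * P) u i = mat_act A (\<lambda>j. \<sigma> * mat_act P u j) i"
    using mat_act_mult[OF A(1) P "2.prems"(5)] by (simp add: mat_act_cmult)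
  also have "\<dots> \<le> mat_act A (\<lambda>j. \<sigma> * (t ^ m * u j)) i"
    using IH by (intro mat_act_mono[OF A "2.prems"(5)])
  also have "\<dots> = t ^ m * (\<sigma> * mat_act A u i)" by (simp add: mat_act_cmult)
  also have "\<dots> \<le> t ^ m * (\<sigma> * (t * u i))"
    using "2.prems"(4)[of A i] "2.prems"(5) t by (intro mult_left_mono[OF _ zero_le_power]) simp_all
  finally show ?case by (simp add: P_def m_def mult_ac)
qed auto

lemma tendsto_prod_list1_perturb:
  assumes "As \<noteq> []" "\<And>A. A \<in> set As \<Longrightarrow> A \<in> carrier_mat N N" "i < N" "j < N"
    and e: "(e \<longlongrightarrow> 0) F"
  shows "((\<lambda>k. prod_list1 (map (perturb (e k)) As) $$ (i, j)) \<longlongrightarrow> prod_list1 As $$ (i, j)) F"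
  using assms(1-4)
proof (induction As arbitrary: i j rule: prod_list1.induct)
  case (1 A)
  then show ?case using tendsto_add[OF tendsto_const e, of "A $$ (i, j)"]
    by (simp add: index_perturb[of _ N N])
next
  case (2 A B As)
  have A: "A \<in> carrier_mat N N" and As: "\<And>C. C \<in> set (B # As) \<Longrightarrow> C \<in> carrier_mat N N"
    using "2.prems" by auto
  have P: "prod_list1 (B # As) \<in> carrier_mat N N" using As by (intro prod_list1_carrier) auto
  have Pe: "prod_list1 (map (perturb x) (B # As)) \<in> carrier_mat N N" for x
    using As by (intro prod_list1_carrier) (auto intro: perturb_carrier)
  have "((\<lambda>k. \<Sum>l<N. (A $$ (i, l) + e k) * prod_list1 (map (perturb (e k)) (B # As)) $$ (l, j))
      \<longlongrightarrow> (\<Sum>l<N. (A $$ (i, l) + 0) * prod_list1 (B # As) $$ (l, j))) F"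
    by (intro tendsto_intros e "2.IH") (use "2.prems" As in auto)
  moreover have "(perturb x A * prod_list1 (map (perturb x) (B # As))) $$ (i, j) =
      (\<Sum>l<N. (A $$ (i, l) + x) * prod_list1 (map (perturb x) (B # As)) $$ (l, j))" for x
    using carrier_matD[OF A] carrier_matD[OF Pe[of x]] "2.prems"(3,4)
    by (auto simp: perturb_def scalar_prod_def lessThan_atLeast0 simp del: prod_list1.simps list.map
        intro!: sum.cong)
  moreover have "(A * prod_list1 (B # As)) $$ (i, j) =
      (\<Sum>l<N. A $$ (i, l) * prod_list1 (B # As) $$ (l, j))"
    using carrier_matD[OF A] carrier_matD[OF P] "2.prems"(3,4)
    by (auto simp: scalar_prod_def lessThan_atLeast0 simp del: prod_list1.simps intro!: sum.cong)
  ultimately show ?case by simp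
qed auto

section \<open>Bounds for the spectral radii of all products\<close>

lemma spec_rad_prod_list1_le:
  assumes S: "selective N N S" and N: "N > 0" and le: "\<And>A. A \<in> S \<Longrightarrow> spec_rad A \<le> t"
    and As: "As \<noteq> []" "set As \<subseteq> mat_convex_hull S"
  shows "spec_rad (prod_list1 As) \<le> t ^ length As"
proof -
  note S' = selectiveD[OF S]
  have car: "B \<in> S \<Longrightarrow> B \<in> carrier_mat N N" for B using S'(2) by auto
  have hull: "B \<in> carrier_mat N N" "nonneg_matrix B" if "B \<in> set As" for B
    using mat_convex_hull_nonneg[OF S'(2,3)] As(2) that by auto
  have "\<exists>A\<in>S. spec_rad (prod_list1 As) \<le> spec_rad (perturb e A) ^ length As"
    if e: "e > 0" for e
  proof -
    obtain A u where A: "A \<in> S" and u: "\<And>i. i < N \<Longrightarrow> 0 < u i"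
      and eig: "\<And>i. i < N \<Longrightarrow> mat_act (perturb e A) u i = spec_rad (perturb e A) * u i"
      and ext: "\<And>B i. B \<in> S \<Longrightarrow> i < N \<Longrightarrow> -1 * mat_act A u i \<le> -1 * mat_act B u i"
      using selective_extremal_matrix[OF S N e, of "-1"] by auto
    \<comment> \<open>Dropping the shift only decreases the image, so for this direction the factors
      of the product stay unperturbed.\<close>
    have "0 \<le> e * (\<Sum>j<N. u j)" using e u by (intro mult_nonneg_nonneg sum_nonneg) (auto intro: less_imp_le)
    then have actA: "mat_act A u i \<le> spec_rad (perturb e A) * u i" if "i < N" for i
      using eig[OF that] by (simp add: mat_act_perturb[OF car[OF A] that])
    have "1 * mat_act (prod_list1 As) u i \<le> 1 * (spec_rad (perturb e A) ^ length As * u i)"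
      if "i < N" for i
    proof (rule mat_act_prod_list1_le[OF As(1) hull _ _ that])
      fix B i assume B: "B \<in> set As" and i: "i < N"
      have "- mat_act A u i \<le> -1 * mat_act B u i"
        using mat_convex_hull_mat_act_ge[OF S'(2) _ i, of B "- mat_act A u i" "-1" u] ext i B As(2)
        by auto
      with actA[OF i] show "1 * mat_act B u i \<le> 1 * (spec_rad (perturb e A) * u i)" by simp
    qed (use spec_rad_nonneg[OF perturb_carrier[OF car[OF A]] N] in auto)
    then have "spec_rad (prod_list1 As) \<le> spec_rad (perturb e A) ^ length As"
      using hull As(1) u N
      by (intro spec_rad_le_subinvariant[of _ N u] prod_list1_carrier prod_list1_nonneg) auto
    with A show ?thesis by blast
  qed
  \<comment> \<open>With \<open>e = 1 / (k + 1)\<close> the matrix \<open>X k\<close> still depends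
    on \<open>k\<close>; compactness of \<open>S\<close> yields a subsequence converging to some
    \<open>A\<close> in \<open>S\<close>, to which the bound \<open>t\<close> applies.\<close>
  then have "\<forall>k. \<exists>A\<in>S. spec_rad (prod_list1 As) \<le> spec_rad (perturb (inverse (real (Suc k))) A) ^ length As"
    by simp
  then obtain X where X: "\<And>k. X k \<in> S"
    "\<And>k. spec_rad (prod_list1 As) \<le> spec_rad (perturb (inverse (real (Suc k))) (X k)) ^ length As"
    by metis
  have "seq_compact (mat_entries ` S)"
    using S'(4) unfolding compact_mats_def by (rule compact_imp_seq_compact)
  then obtain l q where l: "l \<in> mat_entries ` S" and q: "strict_mono q"
    and lim: "((\<lambda>k. mat_entries (X k)) \<circ> q) \<longlonglongrightarrow> l"
    using X(1) by (auto elim!: seq_compactE[of _ "\<lambda>k. mat_entries (X k)"])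
  obtain A where A: "A \<in> S" "l = mat_entries A" using l by auto
  have e: "(\<lambda>k. inverse (real (Suc (q k)))) \<longlonglongrightarrow> 0"
    using LIMSEQ_subseq_LIMSEQ[OF LIMSEQ_inverse_real_of_nat q] by (simp add: o_def)
  have "(\<lambda>k. spec_rad (perturb (inverse (real (Suc (q k)))) (X (q k)))) \<longlonglongrightarrow> spec_rad A"
  proof (rule tendsto_spec_rad[OF _ car[OF A(1)] N])
    fix i j assume ij: "i < N" "j < N"
    have "(\<lambda>k. mat_entries (X (q k)) (i, j) + inverse (real (Suc (q k)))) \<longlonglongrightarrow> mat_entries A (i, j) + 0"
      using tendsto_coordinate[OF lim, of "(i, j)"] e A(2) by (intro tendsto_add) (auto simp: o_def)
    then show "(\<lambda>k. perturb (inverse (real (Suc (q k)))) (X (q k)) $$ (i, j)) \<longlonglongrightarrow> A $$ (i, j)"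
      using ij car X(1) A(1) by (simp add: index_perturb[OF car] mat_entries_carrier[OF car])
  qed (use X(1) car in \<open>auto intro: perturb_carrier\<close>)
  then have "spec_rad (prod_list1 As) \<le> spec_rad A ^ length As"
    using X(2) by (intro tendsto_lowerbound[OF tendsto_power]) auto
  also have "\<dots> \<le> t ^ length As"
    using le[OF A(1)] spec_rad_nonneg[OF car[OF A(1)] N] by (rule power_mono)
  finally show ?thesis .
qed

lemma spec_rad_prod_list1_ge:
  assumes S: "selective N N S" and N: "N > 0" and ge: "\<And>A. A \<in> S \<Longrightarrow> t \<le> spec_rad A"
    and t: "0 \<le> t" and As: "As \<noteq> []" "set As \<subseteq> mat_convex_hull S"
  shows "t ^ length As \<le> spec_rad (prod_list1 As)"
proof -
  note S' = selectiveD[OF S]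
  have car: "B \<in> S \<Longrightarrow> B \<in> carrier_mat N N" for B using S'(2) by auto
  have hull: "B \<in> carrier_mat N N" "nonneg_matrix B" if "B \<in> set As" for B
    using mat_convex_hull_nonneg[OF S'(2,3)] As(2) that by auto
  \<comment> \<open>Here the factors must be perturbed as well: without the shift their images of
    \<open>u\<close> might fall below the multiple \<open>spec_rad (perturb e A)\<close> of
    \<open>u\<close>.\<close>
  have bound: "t ^ length As \<le> spec_rad (prod_list1 (map (perturb e) As))" if e: "e > 0" for e
  proof -
    obtain A u where A: "A \<in> S" and u: "\<And>i. i < N \<Longrightarrow> 0 < u i"
      and eig: "\<And>i. i < N \<Longrightarrow> mat_act (perturb e A) u i = spec_rad (perturb e A) * u i"
      and ext: "\<And>B i. B \<in> S \<Longrightarrow> i < N \<Longrightarrow> 1 * mat_act A u i \<le> 1 * mat_act B u i"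
      using selective_extremal_matrix[OF S N e, of 1] by auto
    have "0 \<le> e * (\<Sum>j<N. u j)" using e u by (intro mult_nonneg_nonneg sum_nonneg) (auto intro: less_imp_le)
    \<comment> \<open>The Perron vector of the perturbed matrix is subinvariant for
      \<open>A\<close>, so perturbing does not lower the spectral radius and \<open>t\<close>
      remains a bound for every \<open>e\<close>.\<close>
    then have "mat_act A u i \<le> spec_rad (perturb e A) * u i" if "i < N" for i
      using eig[OF that] by (simp add: mat_act_perturb[OF car[OF A] that])
    with u have "spec_rad A \<le> spec_rad (perturb e A)"
      by (intro spec_rad_le_subinvariant[OF car[OF A] N S'(3)[OF A], where u = u]) auto
    then have t_le: "t \<le> spec_rad (perturb e A)" using ge[OF A] by simp
    have pert: "perturb e B \<in> carrier_mat N N" "nonneg_matrix (perturb e B)" if "B \<in> set As" for B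
      using hull[OF that] e by (auto simp: nonneg_matrix_iff perturb_def)
    have "-1 * mat_act (prod_list1 (map (perturb e) As)) u i
        \<le> -1 * (spec_rad (perturb e A) ^ length (map (perturb e) As) * u i)"
      if "i < N" for i
    proof (rule mat_act_prod_list1_le[OF _ _ _ _ _ that])
      fix C i assume "C \<in> set (map (perturb e) As)" and i: "i < N"
      then obtain B where B: "B \<in> set As" "C = perturb e B" by auto
      have "mat_act A u i \<le> 1 * mat_act B u i"
        using mat_convex_hull_mat_act_ge[OF S'(2) _ i, of B "mat_act A u i" 1 u] ext i B As(2)
        by auto
      with eig[OF i] show "-1 * mat_act C u i \<le> -1 * (spec_rad (perturb e A) * u i)"
        by (simp add: B mat_act_perturb[OF hull(1)[OF B(1)] i] mat_act_perturb[OF car[OF A] i])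
    qed (use t t_le As pert in auto)
    then have "spec_rad (perturb e A) ^ length As \<le> spec_rad (prod_list1 (map (perturb e) As))"
      using pert As(1) u N
      by (intro spec_rad_ge_superinvariant[of _ N u 0] prod_list1_carrier prod_list1_nonneg)
        (auto intro: less_imp_le)
    moreover have "t ^ length As \<le> spec_rad (perturb e A) ^ length As"
      using t_le t by (rule power_mono)
    ultimately show ?thesis by simp
  qed
  have "(\<lambda>k. spec_rad (prod_list1 (map (perturb (inverse (real (Suc k)))) As)))
      \<longlonglongrightarrow> spec_rad (prod_list1 As)"
    using As(1) hull N
    by (intro tendsto_spec_rad[of _ N] prod_list1_carrier tendsto_prod_list1_perturb LIMSEQ_inverse_real_of_nat)
      (auto intro: perturb_carrier)
  then show ?thesis by (rule tendsto_lowerbound) (auto intro!: always_eventually bound)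
qed

text \<open>Both product bounds, applied to the selective set \<open>{A}\<close>, meet at
  \<open>spec_rad A ^ m\<close>.\<close>

lemma spec_rad_prod_list1_replicate:
  assumes A: "A \<in> carrier_mat N N" "nonneg_matrix A" and N: "N > 0" and m: "m \<ge> 1"
  shows "spec_rad (prod_list1 (replicate m A)) = spec_rad A ^ m"
proof (rule antisym)
  have hull: "set (replicate m A) \<subseteq> mat_convex_hull {A}"
    unfolding mat_convex_hull_def using hull_subset[of "{A}" convex_mats] by auto
  have ne: "replicate m A \<noteq> []" using m by auto
  show "spec_rad (prod_list1 (replicate m A)) \<le> spec_rad A ^ m"
    using spec_rad_prod_list1_le[OF selective_singleton[OF A] N _ ne hull, of "spec_rad A"] by simp
  show "spec_rad A ^ m \<le> spec_rad (prod_list1 (replicate m A))"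
    using spec_rad_prod_list1_ge[OF selective_singleton[OF A] N _ _ ne hull, of "spec_rad A"]
      spec_rad_nonneg[OF A(1) N] by simp
qed

text \<open>An extremal matrix of \<open>S\<close>, repeated \<open>m\<close> times, attains the
  bound valid for all products from \<open>T\<close>; so the quantities do not depend on
  \<open>m\<close>.\<close>

lemma selective_min_max_identities:
  assumes S: "selective N N S" and N: "N > 0" and ST: "S \<subseteq> T" and T: "T \<subseteq> mat_convex_hull S"
  shows "((\<forall>m\<ge>1. rho_check_m m T = rho_min S) \<and>
          lower_spectral_radius T = rho_min T \<and> rho_min T = rho_min S)" (is ?lower)
    and "((\<forall>m\<ge>1. rho_hat_m m T = rho_max S) \<and>
          generalized_spectral_radius T = rho_max T \<and> rho_max T = rho_max S)" (is ?upper)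
proof -
  note S' = selectiveD[OF S]
  have car: "B \<in> S \<Longrightarrow> B \<in> carrier_mat N N" for B using S'(2) by auto
  have cont: "continuous_on UNIV (\<lambda>a. \<sigma> * spec_rad (mat N N (\<lambda>ij. a ij + 0)))" for \<sigma> :: real
    by (rule continuous_on_mult[OF continuous_on_const continuous_spec_rad[OF N]])
  have id: "mat N N (\<lambda>ij. mat_entries B ij + 0) = B" if "B \<in> S" for B
    using car[OF that] by (intro eq_matI) (auto simp: mat_entries_def)
  have prod: "spec_rad (prod_list1 (replicate m A)) = spec_rad A ^ m" if "A \<in> S" "m \<ge> 1" for A m
    using spec_rad_prod_list1_replicate[OF car S'(3) N] that by blast
  have root: "root m (spec_rad A ^ m) = spec_rad A" if "A \<in> S" "m \<ge> 1" for A m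
    using spec_rad_nonneg[OF car N] that by (intro real_root_power_cancel) auto

  obtain A where A: "A \<in> S" "\<And>B. B \<in> S \<Longrightarrow> spec_rad A \<le> spec_rad B"
    using compact_mats_attains_inf[OF S'(4,1) cont[of 1]] id by auto
  have geA: "spec_rad A ^ length As \<le> spec_rad (prod_list1 As)"
    if "As \<noteq> []" "set As \<subseteq> T" for As
    using spec_rad_prod_list1_ge[OF S N A(2) spec_rad_nonneg[OF car[OF A(1)] N]] that T by auto
  \<comment> \<open>A general \<open>X\<close> between \<open>S\<close> and \<open>T\<close> covers
    both ends at once; single matrices are products of length one.\<close>
  have min: "rho_min X = spec_rad A" if X: "S \<subseteq> X" "X \<subseteq> T" for X
    unfolding rho_min_def
  proof (rule Least_equality)
    show "spec_rad A \<in> spec_rad ` X" using X A by auto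
    show "spec_rad A \<le> y" if "y \<in> spec_rad ` X" for y
      using that geA[of "[_]"] X by auto
  qed
  have check: "rho_check_m m T = spec_rad A" if m: "m \<ge> 1" for m
    unfolding rho_check_m_def
  proof (rule cInf_eq_minimum)
    show "spec_rad A \<in> {root m (spec_rad (prod_list1 As)) |As. length As = m \<and> set As \<subseteq> T}"
      using prod[OF A(1) m] root[OF A(1) m] A(1) ST
      by (auto intro!: exI[of _ "replicate m A"])
    fix x assume "x \<in> {root m (spec_rad (prod_list1 As)) |As. length As = m \<and> set As \<subseteq> T}"
    then obtain As where As: "length As = m" "set As \<subseteq> T" "x = root m (spec_rad (prod_list1 As))"
      by auto
    moreover have "As \<noteq> []" using As(1) m by auto
    ultimately have "spec_rad A ^ m \<le> spec_rad (prod_list1 As)" using geA[of As] by simp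
    then have "root m (spec_rad A ^ m) \<le> x" using As m by simp
    then show "spec_rad A \<le> x" using root[OF A(1) m] by simp
  qed
  \<comment> \<open>The infimum runs over a family that is constant in \<open>m\<close>.\<close>
  have "lower_spectral_radius T = spec_rad A"
    unfolding lower_spectral_radius_def using check by simp
  then show ?lower using min check ST by simp

  obtain C where C: "C \<in> S" "\<And>B. B \<in> S \<Longrightarrow> spec_rad B \<le> spec_rad C"
    using compact_mats_attains_inf[OF S'(4,1) cont[of "-1"]] id by auto
  have leC: "spec_rad (prod_list1 As) \<le> spec_rad C ^ length As"
    if "As \<noteq> []" "set As \<subseteq> T" for As
    using spec_rad_prod_list1_le[OF S N C(2)] that T by auto
  have max: "rho_max X = spec_rad C" if X: "S \<subseteq> X" "X \<subseteq> T" for X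
    unfolding rho_max_def
  proof (rule Greatest_equality)
    show "spec_rad C \<in> spec_rad ` X" using X C by auto
    show "y \<le> spec_rad C" if "y \<in> spec_rad ` X" for y
      using that leC[of "[_]"] X by auto
  qed
  have hat: "rho_hat_m m T = spec_rad C" if m: "m \<ge> 1" for m
    unfolding rho_hat_m_def
  proof (rule cSup_eq_maximum)
    show "spec_rad C \<in> {root m (spec_rad (prod_list1 As)) |As. length As = m \<and> set As \<subseteq> T}"
      using prod[OF C(1) m] root[OF C(1) m] C(1) ST
      by (auto intro!: exI[of _ "replicate m C"])
    fix x assume "x \<in> {root m (spec_rad (prod_list1 As)) |As. length As = m \<and> set As \<subseteq> T}"
    then obtain As where As: "length As = m" "set As \<subseteq> T" "x = root m (spec_rad (prod_list1 As))"
      by auto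
    moreover have "As \<noteq> []" using As(1) m by auto
    ultimately have "spec_rad (prod_list1 As) \<le> spec_rad C ^ m" using leC[of As] by simp
    then have "x \<le> root m (spec_rad C ^ m)" using As m by simp
    then show "x \<le> spec_rad C" using root[OF C(1) m] by simp
  qed
  have "generalized_spectral_radius T = spec_rad C"
    unfolding generalized_spectral_radius_def using hat by simp
  then show ?upper using max hat ST by simp
qed

theorem corollary1:
  fixes N n d :: nat
    and F :: "nat \<Rightarrow> real mat set"
    and r c :: "nat \<Rightarrow> nat"
    and ws :: "nat list list"
    and p :: "nat list \<Rightarrow> real"
    and S T :: "real mat set"
  assumes "N \<ge> 1" and "n \<ge> 1" and "d \<ge> 1"
    and dims: "\<And>i. i \<in> {1..n} \<Longrightarrow> r i \<ge> 1 \<and> c i \<ge> 1"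
    and args: "\<And>i. i \<in> {1..n} \<Longrightarrow> F i \<noteq> {} \<and>
          (linearly_ordered_nonneg (r i) (c i) (F i) \<or>
           IRU_set (r i) (c i) (F i) \<and> compact_mats (F i) \<and> (\<forall>A\<in>F i. nonneg_matrix A))"
    and "ws \<noteq> []" and "distinct ws"
    and words: "\<And>w. w \<in> set ws \<Longrightarrow>
          1 \<le> length w \<and> length w \<le> d \<and> set w \<subseteq> {1..n} \<and> word_compatible r c N w"
    and coeffs: "\<And>w. w \<in> set ws \<Longrightarrow> p w > 0"
    and "S = minkowski_poly p ws F"
    and "T \<subseteq> carrier_mat N N" and "compact_mats T"
    and "S \<subseteq> T" and "T \<subseteq> mat_convex_hull S"
  shows "((\<forall>m\<ge>1. rho_check_m m T = rho_min S) \<and>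
          lower_spectral_radius T = rho_min T \<and> rho_min T = rho_min S) \<and>
         ((\<forall>m\<ge>1. rho_hat_m m T = rho_max S) \<and>
          generalized_spectral_radius T = rho_max T \<and> rho_max T = rho_max S)"
proof -
  have "selective (r i) (c i) (F i)" if "i \<in> {1..n}" for i
    using args[OF that] selective_linearly_ordered selective_IRU by blast
  then have "selective N N S"
    unfolding \<open>S = minkowski_poly p ws F\<close>
    using \<open>ws \<noteq> []\<close> words coeffs
    by (intro selective_minkowski_poly[where r = r and c = c]) (fastforce intro: less_imp_le)+
  then show ?thesis
    using selective_min_max_identities[of N S T] \<open>N \<ge> 1\<close> \<open>S \<subseteq> T\<close> \<open>T \<subseteq> mat_convex_hull S\<close>
    by simp
qed

end
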